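(* Let $T,\sigma,\sigma_0,\gamma>0$ and $\mu_0\in\mathbb R$ be constants. Let $k:[0,\infty)\to[0,\infty)$ be increasing, convex and twice continuously differentiable, with $k(0)=0$, $k''(x)>0$ for every $x\in(0,\infty)$, $\lim_{x\to0+}k'(x)=0$, $\lim_{x\to+\infty}k'(x)=+\infty$, and $k''(0):=\lim_{x\to0+}k''(x)>0$. Then the Hamilton–Jacobi equation $$\begin{cases}\Gamma_t(t,u)+\dfrac{\sigma_0^2}{2\sigma^2}\dfrac1{\sigma_0^2u+1}+\widetilde k^*(\Gamma_u(t,u))=0,& (t,u)\in[0,T)\times[0,\infty),\\ \Gamma(T,u)=-\dfrac{\mu_0^2}{2\sigma_0^2},& u\in[0,\infty),\end{cases}$$ admits a unique classical solution $\Gamma\in C^2([0,T)\times[0,\infty))\cap C([0,T]\times[0,\infty))$, and this solution satisfies $\Gamma_u(t,u)\le0$ for all $(t,u)\in[0,T)\times[0,\infty)$.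
   Context: $k^*(y)=\sup_{x\ge0}\{xy-k(x)\}$ for $y\in[0,\infty)$ is the Legendre–Fenchel conjugate of $k$, and $\widetilde k^*(x)=-\gamma k^*(-x/\gamma)$ for $x\in(-\infty,0]$. (Since $k''(0)>0$, $k^*$ is $C^2$ up to $0$ and may be extended to a $C^2$ function on $\mathbb R$, $\widetilde k^*$ accordingly.) *)

theory Defs
  imports "HOL-Analysis.Analysis"
begin

text \<open>
  Twice continuous differentiability on a set that need not be open: Frechet derivatives are
  taken relative to \<open>S\<close> and are continuous up to those boundary points that belong to \<open>S\<close>.
  On the sets used below (\<open>UNIV\<close> and a product of two nondegenerate intervals) these relative
  derivatives are unique.
\<close>

definition C2_on :: "'a::real_normed_vector set \<Rightarrow> ('a \<Rightarrow> 'b::real_normed_vector) \<Rightarrow> bool" where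
  "C2_on S f \<longleftrightarrow>
    (\<exists>(f' :: 'a \<Rightarrow> 'a \<Rightarrow>\<^sub>L 'b) (f'' :: 'a \<Rightarrow> 'a \<Rightarrow>\<^sub>L 'a \<Rightarrow>\<^sub>L 'b).
      (\<forall>x\<in>S. (f has_derivative blinfun_apply (f' x)) (at x within S)) \<and>
      (\<forall>x\<in>S. (f' has_derivative blinfun_apply (f'' x)) (at x within S)) \<and>
      continuous_on S f'')"

text \<open>
  The supremum is a real one; under the assumption that \<open>k'\<close> tends to infinity the set is
  bounded above for every \<open>y\<close>. Only the values at \<open>y \<ge> 0\<close> are used.
\<close>

definition conjugate :: "(real \<Rightarrow> real) \<Rightarrow> real \<Rightarrow> real" where
  "conjugate k y = (SUP x\<in>{0..}. x * y - k x)"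

text \<open>Here \<open>K\<close> stands for the conjugate of \<open>k\<close>, or for an extension of it to the real line.\<close>

definition tilde :: "real \<Rightarrow> (real \<Rightarrow> real) \<Rightarrow> real \<Rightarrow> real" where
  "tilde \<gamma> K x = - \<gamma> * K (- x / \<gamma>)"

text \<open>Partial derivatives on \<open>[0,T) \<times> [0,\<infinity>)\<close>, one-sided at \<open>t = 0\<close> and at \<open>u = 0\<close>.\<close>

definition D_t :: "real \<Rightarrow> (real \<times> real \<Rightarrow> real) \<Rightarrow> real \<Rightarrow> real \<Rightarrow> real" where
  "D_t T \<Gamma> t u = vector_derivative (\<lambda>s. \<Gamma> (s, u)) (at t within {0..<T})"

definition D_u :: "(real \<times> real \<Rightarrow> real) \<Rightarrow> real \<Rightarrow> real \<Rightarrow> real" where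
  "D_u \<Gamma> t u = vector_derivative (\<lambda>v. \<Gamma> (t, v)) (at u within {0..})"

definition classical_solution ::
  "real \<Rightarrow> real \<Rightarrow> real \<Rightarrow> real \<Rightarrow> (real \<Rightarrow> real) \<Rightarrow> (real \<times> real \<Rightarrow> real) \<Rightarrow> bool" where
  "classical_solution T \<sigma> \<sigma>\<^sub>0 \<mu>\<^sub>0 H \<Gamma> \<longleftrightarrow>
    C2_on ({0..<T} \<times> {0..}) \<Gamma> \<and>
    continuous_on ({0..T} \<times> {0..}) \<Gamma> \<and>
    (\<forall>t\<in>{0..<T}. \<forall>u\<in>{0..}.
      D_t T \<Gamma> t u + \<sigma>\<^sub>0\<^sup>2 / (2 * \<sigma>\<^sup>2) * (1 / (\<sigma>\<^sub>0\<^sup>2 * u + 1)) + H (D_u \<Gamma> t u) = 0) \<and>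
    (\<forall>u\<in>{0..}. \<Gamma> (T, u) = - (\<mu>\<^sub>0\<^sup>2 / (2 * \<sigma>\<^sub>0\<^sup>2)))"

lemma C2_on_real_UNIV:
  fixes f f' f'' :: "real \<Rightarrow> real"
  assumes "\<And>x. (f has_real_derivative f' x) (at x)"
    and "\<And>x. (f' has_real_derivative f'' x) (at x)"
    and "continuous_on UNIV f''"
  shows "C2_on UNIV f"
  unfolding C2_on_def
proof (intro exI conjI ballI)
  let ?I = "blinfun_scaleR_left (1::real) :: real \<Rightarrow>\<^sub>L real"
  fix x :: real
  have "blinfun_apply (f' x *\<^sub>R ?I) = (*) (f' x)"
    by (auto simp: blinfun.scaleR_left)
  then show "(f has_derivative blinfun_apply (f' x *\<^sub>R ?I)) (at x)"
    using assms(1)[of x] by (simp add: has_field_derivative_def)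
  have "((\<lambda>x. f' x *\<^sub>R ?I) has_derivative (\<lambda>h. (f'' x * h) *\<^sub>R ?I)) (at x)"
    using assms(2)[of x] unfolding has_field_derivative_def
    by (rule has_derivative_scaleR_left)
  moreover have "blinfun_apply (f'' x *\<^sub>R blinfun_scaleR_left ?I) = (\<lambda>h. (f'' x * h) *\<^sub>R ?I)"
    by (auto simp: blinfun.scaleR_left)
  ultimately show "((\<lambda>x. f' x *\<^sub>R ?I) has_derivative
      blinfun_apply (f'' x *\<^sub>R blinfun_scaleR_left ?I)) (at x)"
    by simp
next
  show "continuous_on UNIV
      (\<lambda>x. f'' x *\<^sub>R blinfun_scaleR_left (blinfun_scaleR_left (1::real) :: real \<Rightarrow>\<^sub>L real))"
    by (intro continuous_intros assms(3))
qed

lemma glue_at_zero: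
  fixes f d g :: "real \<Rightarrow> real"
  assumes f: "\<And>x. 0 \<le> x \<Longrightarrow> (f has_real_derivative d x) (at x within {0..})"
    and g: "\<And>x. x \<le> 0 \<Longrightarrow> (g has_real_derivative d x) (at x)"
    and fg: "f 0 = g 0"
  shows "((\<lambda>x. if 0 \<le> x then f x else g x) has_real_derivative d x) (at x)"
proof -
  let ?h = "\<lambda>x. if 0 \<le> x then f x else g x"
  have R: "(?h has_real_derivative d x) (at x within {0..})" if "0 \<le> x"
    by (rule has_field_derivative_transform_within[OF f, where d = 1]) (use that in auto)
  have L: "(?h has_real_derivative d x) (at x within {..0})" if "x \<le> 0"
    by (rule has_field_derivative_transform_within[OF has_field_derivative_at_within[OF g], where d = 1])
      (use that fg in auto)
  consider "x < 0" | "x = 0" | "0 < x" by linarith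
  then show ?thesis
  proof cases
    case 1
    then have "at x within {..0} = at x" by (intro at_within_interior) auto
    with L 1 show ?thesis by simp
  next
    case 3
    then have "at x within {0..} = at x" by (intro at_within_interior) auto
    with R 3 show ?thesis by simp
  next
    case 2
    have "(?h has_real_derivative d 0) (at 0 within {..0} \<union> {0..})"
      using L[unfolded 2] R[unfolded 2] unfolding has_field_derivative_iff
      by (intro Lim_Un) auto
    moreover have "{..0::real} \<union> {0..} = UNIV" by auto
    ultimately show ?thesis using 2 by simp
  qed
qed

text \<open>
  The conjugate is C2 up to \<open>0\<close> and has a C2 extension to the real line, so that the hypotheses
  on an extension \<open>K\<close> can be met.
\<close>

lemma conjugate_C2_extension:
  fixes k k' k'' :: "real \<Rightarrow> real"
  assumes k1: "\<And>x. 0 \<le> x \<Longrightarrow> (k has_real_derivative k' x) (at x within {0..})"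
    and k2: "\<And>x. 0 \<le> x \<Longrightarrow> (k' has_real_derivative k'' x) (at x within {0..})"
    and k2c: "continuous_on {0..} k''"
    and k2p: "\<And>x. 0 < x \<Longrightarrow> 0 < k'' x"
    and k10: "(k' \<longlongrightarrow> 0) (at_right 0)"
    and k1inf: "filterlim k' at_top at_top"
    and k20: "0 < k'' 0"
    and k0: "k 0 = 0"
  shows "\<exists>K. C2_on UNIV K \<and> (\<forall>y\<ge>0. K y = conjugate k y)"
proof -
  define c where "c = k'' 0"
  have c: "0 < c" using k20 by (simp add: c_def)
  define d where "d = (\<lambda>x. k'' (max 0 x))"
  define \<phi> where "\<phi> = (\<lambda>x. if 0 \<le> x then k' x else c * x)"
  define \<kappa> where "\<kappa> = (\<lambda>x. if 0 \<le> x then k x else c * x\<^sup>2 / 2)"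
  have k'0: "k' 0 = 0"
  proof -
    have "continuous (at_right 0) k'"
      using DERIV_continuous[OF k2[of 0]] by (rule continuous_within_subset) auto
    then have "(k' \<longlongrightarrow> k' 0) (at_right 0)" by (simp add: continuous_within)
    with k10 show ?thesis using tendsto_unique trivial_limit_at_right_real by blast
  qed
  have d_pos: "0 < d x" for x
    using k2p[of "max 0 x"] k20 by (cases "0 < x") (auto simp: d_def max_def)
  have d_cont: "continuous_on UNIV d"
    unfolding d_def by (rule continuous_on_compose2[OF k2c]) (auto intro!: continuous_intros)
  have D\<phi>: "(\<phi> has_real_derivative d x) (at x)" for x
    unfolding \<phi>_def
    by (rule glue_at_zero)
      (auto simp: d_def max_def c_def k'0 intro!: k2 derivative_eq_intros)
  have D\<kappa>: "(\<kappa> has_real_derivative \<phi> x) (at x)" for x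
    unfolding \<kappa>_def
    by (rule glue_at_zero)
      (auto simp: \<phi>_def k'0 k0 intro!: k1 derivative_eq_intros)
  have \<phi>_cont: "isCont \<phi> x" for x using D\<phi> DERIV_isCont by blast
  have \<phi>_less: "\<phi> x < \<phi> y" if "x < y" for x y
    using DERIV_pos_imp_increasing[OF that] D\<phi> d_pos by blast
  have \<phi>_inj: "\<phi> x = \<phi> y \<Longrightarrow> x = y" for x y
    using \<phi>_less[of x y] \<phi>_less[of y x] by (cases x y rule: linorder_cases) auto
  have \<phi>_surj: "\<exists>x. \<phi> x = y" for y
  proof (cases "0 \<le> y")
    case True
    have "\<forall>\<^sub>F x in at_top. y \<le> k' x \<and> 0 \<le> x"
      using k1inf by (intro eventually_conj eventually_ge_at_top) (simp add: filterlim_at_top)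
    then obtain b where b: "y \<le> k' b" "0 \<le> b"
      using eventually_happens trivial_limit_at_top_linorder by blast
    then have "\<exists>x\<ge>0. x \<le> b \<and> \<phi> x = y"
      using True k'0 by (intro IVT) (auto simp: \<phi>_cont, auto simp: \<phi>_def)
    then show ?thesis by blast
  next
    case False
    then show ?thesis using c
      by (intro exI[of _ "y / c"]) (auto simp: \<phi>_def field_simps mult_less_0_iff)
  qed
  define g where "g = inv \<phi>"
  have \<phi>g: "\<phi> (g y) = y" for y
    unfolding g_def by (rule surj_f_inv_f) (metis \<phi>_surj surjI)
  have g\<phi>: "g (\<phi> x) = x" for x using \<phi>_inj \<phi>g by blast
  have g_cont: "isCont g y" for y
    using isCont_inverse_function2[of "g y - 1" "g y" "g y + 1" g \<phi>] by (simp add: g\<phi> \<phi>_cont \<phi>g)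
  have Dg: "(g has_real_derivative inverse (d (g y))) (at y)" for y
    by (rule DERIV_inverse_function[where f = \<phi> and a = "y - 1" and b = "y + 1"])
      (use d_pos[of "g y"] in \<open>auto simp: D\<phi> \<phi>g g_cont\<close>)
  define K where "K = (\<lambda>y. y * g y - \<kappa> (g y))"
  have DK: "(K has_real_derivative g y) (at y)" for y
    unfolding K_def
    by (rule derivative_eq_intros DERIV_chain2[OF D\<kappa>] Dg refl)+ (simp add: \<phi>g)
  have "C2_on UNIV K"
  proof (rule C2_on_real_UNIV[OF DK Dg])
    have "continuous_on UNIV (\<lambda>y. d (g y))"
      using g_cont
      by (intro continuous_on_compose2[OF d_cont] continuous_at_imp_continuous_on) auto
    then show "continuous_on UNIV (\<lambda>y. inverse (d (g y)))"
      using d_pos by (intro continuous_on_inverse) (auto simp: less_imp_neq[THEN not_sym])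
  qed
  moreover have "K y = conjugate k y" if y: "0 \<le> y" for y
  proof -
    have gy: "0 \<le> g y"
    proof (rule ccontr)
      assume "\<not> 0 \<le> g y"
      then have "\<phi> (g y) < \<phi> 0" by (intro \<phi>_less) simp
      then show False using y by (simp add: \<phi>g) (simp add: \<phi>_def k'0)
    qed
    have max: "x * y - \<kappa> x \<le> g y * y - \<kappa> (g y)" for x
    proof -
      have der: "((\<lambda>x. x * y - \<kappa> x) has_real_derivative y - \<phi> z) (at z)" for z
        by (rule derivative_eq_intros D\<kappa> refl)+ simp
      show ?thesis
      proof (cases "x \<le> g y")
        case True
        show ?thesis
        proof (rule DERIV_nonneg_imp_nondecreasing[OF True, of "\<lambda>x. x * y - \<kappa> x"])
          fix z assume "x \<le> z" "z \<le> g y"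
          then have "\<phi> z \<le> y" using \<phi>_less[of z "g y"] by (cases "z = g y") (auto simp: \<phi>g)
          with der[of z] show "\<exists>D. ((\<lambda>x. x * y - \<kappa> x) has_real_derivative D) (at z) \<and> 0 \<le> D"
            by (intro exI[of _ "y - \<phi> z"]) auto
        qed
      next
        case False
        show ?thesis
        proof (rule DERIV_nonpos_imp_nonincreasing[of "g y" x "\<lambda>x. x * y - \<kappa> x"])
          show "g y \<le> x" using False by simp
          fix z assume "g y \<le> z" "z \<le> x"
          then have "y \<le> \<phi> z" using \<phi>_less[of "g y" z] by (cases "z = g y") (auto simp: \<phi>g)
          with der[of z] show "\<exists>D. ((\<lambda>x. x * y - \<kappa> x) has_real_derivative D) (at z) \<and> D \<le> 0"
            by (intro exI[of _ "y - \<phi> z"]) auto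
        qed
      qed
    qed
    have "conjugate k y = g y * y - k (g y)"
      unfolding conjugate_def
    proof (rule cSup_eq_maximum)
      show "g y * y - k (g y) \<in> (\<lambda>x. x * y - k x) ` {0..}" using gy by auto
      fix v assume "v \<in> (\<lambda>x. x * y - k x) ` {0..}"
      then obtain x where x: "0 \<le> x" "v = x * y - k x" by auto
      then show "v \<le> g y * y - k (g y)" using max[of x] gy by (simp add: \<kappa>_def)
    qed
    then show ?thesis using gy by (simp add: K_def \<kappa>_def mult.commute)
  qed
  ultimately show ?thesis by blast
qed

end

theory Submission
  imports Defs
begin

text \<open>
  Let \<open>f u = \<alpha> B / (B u + 1)\<close> be the running term, \<open>h y = \<gamma> k\<^sup>* (y / \<gamma>)\<close>, \<open>H p = - h (- p)\<close> and
  \<open>p = \<Gamma>\<^sub>u\<close>.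

  Existence: characteristics satisfy \<open>u' = H' p\<close>, \<open>p' = - f' u\<close> and conserve \<open>E = f u + H p\<close>. As
  \<open>f' = - f\<^sup>2 / \<alpha>\<close>, the gradient \<open>p = - y\<close> solves an autonomous equation with parameter \<open>E\<close>, and the time
  left until \<open>p\<close> vanishes is \<open>\<alpha> \<integral> dx / (E + h x)\<^sup>2\<close> over \<open>[0, y]\<close>. The map sending \<open>(E, y)\<close> to
  \<open>(f u, T - t)\<close> is a bijection of the open quadrant with nonvanishing Jacobian; its inverse gives
  \<open>E = - \<Gamma>\<^sub>t\<close> and \<open>y = - \<Gamma>\<^sub>u > 0\<close> as C1 functions, and \<open>\<Gamma>\<close> itself has a closed form in \<open>E\<close> and \<open>y\<close>.

  Uniqueness: the extension of \<open>k\<^sup>*\<close> to negative arguments is arbitrary, so one first shows that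
  every classical solution has \<open>p \<le> 0\<close>: where \<open>p = 0\<close> one has \<open>p\<^sub>t = - f' > 0\<close>, so positivity would
  persist up to the terminal time, at which \<open>p\<close> becomes small in mean, and a barrier excludes this.
  For \<open>p \<le> 0\<close> the Hamiltonian is concave, and two solutions are compared along the
  characteristics of one of them. No growth condition at infinity is needed, because the gradient
  and hence the speed stay bounded along each characteristic.
\<close>

section \<open>Differentiation on the plane\<close>

lemma has_real_derivative_compose_pair:
  fixes g :: "real \<times> real \<Rightarrow> real" and x y :: "real \<Rightarrow> real"
  assumes g: "(g has_derivative (\<lambda>z. a * fst z + b * snd z)) (at (x s, y s))"
    and x: "(x has_real_derivative x') (at s)"
    and y: "(y has_real_derivative y') (at s)"
  shows "((\<lambda>s. g (x s, y s)) has_real_derivative a * x' + b * y') (at s)"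
proof -
  have "((\<lambda>s. (x s, y s)) has_derivative (\<lambda>h. (x' * h, y' * h))) (at s)"
    using x y unfolding has_field_derivative_def by (rule has_derivative_Pair)
  from has_derivative_compose[OF this g]
  have "((\<lambda>s. g (x s, y s)) has_derivative (\<lambda>h. a * (x' * h) + b * (y' * h))) (at s)"
    by simp
  then show ?thesis
    by (rule has_derivative_imp_has_field_derivative) (simp add: algebra_simps)
qed

lemma has_real_derivative_partial_fst:
  fixes g :: "real \<times> real \<Rightarrow> real"
  assumes "(g has_derivative (\<lambda>z. a * fst z + b * snd z)) (at (t, u))"
  shows "((\<lambda>s. g (s, u)) has_real_derivative a) (at t)"
  using has_real_derivative_compose_pair[of g a b "\<lambda>s. s" t "\<lambda>_. u" 1 0] assms by simp

lemma has_real_derivative_partial_snd: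
  fixes g :: "real \<times> real \<Rightarrow> real"
  assumes "(g has_derivative (\<lambda>z. a * fst z + b * snd z)) (at (t, u))"
  shows "((\<lambda>w. g (t, w)) has_real_derivative b) (at u)"
  using has_real_derivative_compose_pair[of g a b "\<lambda>_. t" u "\<lambda>w. w" 0 1] assms by simp

text \<open>Schwarz's theorem: the second difference of \<open>f\<close> over a small square,
  evaluated by the mean value theorem in both orders, is the squared side times a value of
  \<open>a2\<close> and also times a value of \<open>b1\<close>. Continuity at the corner makes both
  values close to those at \<open>(t, u)\<close>.\<close>

lemma mixed_partials_eq:
  fixes f a b a2 b1 :: "real \<times> real \<Rightarrow> real"
  assumes \<Omega>: "open \<Omega>" "(t, u) \<in> \<Omega>"
    and a: "\<And>s w. (s, w) \<in> \<Omega> \<Longrightarrow> ((\<lambda>s. f (s, w)) has_real_derivative a (s, w)) (at s)"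
    and b: "\<And>s w. (s, w) \<in> \<Omega> \<Longrightarrow> ((\<lambda>w. f (s, w)) has_real_derivative b (s, w)) (at w)"
    and a2: "\<And>s w. (s, w) \<in> \<Omega> \<Longrightarrow> ((\<lambda>w. a (s, w)) has_real_derivative a2 (s, w)) (at w)"
    and b1: "\<And>s w. (s, w) \<in> \<Omega> \<Longrightarrow> ((\<lambda>s. b (s, w)) has_real_derivative b1 (s, w)) (at s)"
    and cont: "isCont a2 (t, u)" "isCont b1 (t, u)"
  shows "a2 (t, u) = b1 (t, u)"
proof (rule ccontr)
  assume ne: "a2 (t, u) \<noteq> b1 (t, u)"
  define e where "e = \<bar>a2 (t, u) - b1 (t, u)\<bar> / 2"
  have e: "0 < e" using ne by (simp add: e_def)
  obtain d1 where d1: "0 < d1" "\<And>z. dist z (t, u) < d1 \<Longrightarrow> dist (a2 z) (a2 (t, u)) < e"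
    using cont(1) e unfolding continuous_at_eps_delta by metis
  obtain d2 where d2: "0 < d2" "\<And>z. dist z (t, u) < d2 \<Longrightarrow> dist (b1 z) (b1 (t, u)) < e"
    using cont(2) e unfolding continuous_at_eps_delta by metis
  obtain d3 where d3: "0 < d3" "ball (t, u) d3 \<subseteq> \<Omega>"
    using \<Omega> open_contains_ball by blast
  \<comment> \<open>Points of the square lie within \<open>2 * h\<close> of the corner; the factor 4
    leaves a strict margin.\<close>
  define h where "h = min d1 (min d2 d3) / 4"
  have h: "0 < h" using d1 d2 d3 by (simp add: h_def)
  have near: "dist (s, w) (t, u) < min d1 (min d2 d3)"
    if "t \<le> s" "s \<le> t + h" "u \<le> w" "w \<le> u + h" for s w
  proof -
    have "dist (s, w) (t, u) \<le> \<bar>s - t\<bar> + \<bar>w - u\<bar>"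
      by (simp add: dist_Pair_Pair dist_real_def sqrt_sum_squares_le_sum_abs)
    also have "\<dots> \<le> 2 * h" using that by simp
    also have "\<dots> < 4 * h" using h by simp
    finally show ?thesis by (simp add: h_def)
  qed
  have in\<Omega>: "(s, w) \<in> \<Omega>" if "t \<le> s" "s \<le> t + h" "u \<le> w" "w \<le> u + h" for s w
    using near[OF that] d3(2) by (auto simp: dist_commute subset_iff)
  have "\<exists>s>t. s < t + h \<and> (f (t + h, u + h) - f (t + h, u)) - (f (t, u + h) - f (t, u))
      = (t + h - t) * (a (s, u + h) - a (s, u))"
    using h by (intro MVT2) (auto intro!: DERIV_diff a in\<Omega>)
  then obtain s1 where s1: "t < s1" "s1 < t + h"
    "(f (t + h, u + h) - f (t + h, u)) - (f (t, u + h) - f (t, u)) = h * (a (s1, u + h) - a (s1, u))"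
    by auto
  have "\<exists>w>u. w < u + h \<and> a (s1, u + h) - a (s1, u) = (u + h - u) * a2 (s1, w)"
    using h s1 by (intro MVT2) (auto intro!: a2 in\<Omega>)
  then obtain w1 where w1: "u < w1" "w1 < u + h" "a (s1, u + h) - a (s1, u) = h * a2 (s1, w1)"
    by auto
  have "\<exists>w>u. w < u + h \<and> (f (t + h, u + h) - f (t, u + h)) - (f (t + h, u) - f (t, u))
      = (u + h - u) * (b (t + h, w) - b (t, w))"
    using h by (intro MVT2) (auto intro!: DERIV_diff b in\<Omega>)
  then obtain w2 where w2: "u < w2" "w2 < u + h"
    "(f (t + h, u + h) - f (t, u + h)) - (f (t + h, u) - f (t, u)) = h * (b (t + h, w2) - b (t, w2))"
    by auto
  have "\<exists>s>t. s < t + h \<and> b (t + h, w2) - b (t, w2) = (t + h - t) * b1 (s, w2)"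
    using h w2 by (intro MVT2) (auto intro!: b1 in\<Omega>)
  then obtain s2 where s2: "t < s2" "s2 < t + h" "b (t + h, w2) - b (t, w2) = h * b1 (s2, w2)"
    by auto
  have "h * (h * a2 (s1, w1)) = h * (h * b1 (s2, w2))"
    using s1 w1 w2 s2 by (simp add: algebra_simps)
  then have "a2 (s1, w1) = b1 (s2, w2)" using h by simp
  moreover have "dist (a2 (s1, w1)) (a2 (t, u)) < e"
    using near[of s1 w1] s1 w1 by (intro d1) auto
  moreover have "dist (b1 (s2, w2)) (b1 (t, u)) < e"
    using near[of s2 w2] s2 w2 by (intro d2) auto
  ultimately show False
    by (simp add: e_def dist_real_def) argo
qed

text \<open>The operator-valued derivatives are assembled from the two coordinate projections.
  Everything is relative to \<open>S\<close>, so boundary points are covered.\<close>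

lemma C2_on_pairI:
  fixes v a b a1 a2 b1 b2 :: "real \<times> real \<Rightarrow> real"
  assumes v: "\<And>z. z \<in> S \<Longrightarrow> (v has_derivative (\<lambda>h. a z * fst h + b z * snd h)) (at z within S)"
    and a: "\<And>z. z \<in> S \<Longrightarrow> (a has_derivative (\<lambda>h. a1 z * fst h + a2 z * snd h)) (at z within S)"
    and b: "\<And>z. z \<in> S \<Longrightarrow> (b has_derivative (\<lambda>h. b1 z * fst h + b2 z * snd h)) (at z within S)"
    and cont: "continuous_on S a1" "continuous_on S a2" "continuous_on S b1" "continuous_on S b2"
  shows "C2_on S v"
  unfolding C2_on_def
proof (intro exI conjI ballI)
  let ?e1 = "Blinfun fst :: (real \<times> real) \<Rightarrow>\<^sub>L real"
  let ?e2 = "Blinfun snd :: (real \<times> real) \<Rightarrow>\<^sub>L real"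
  have e [simp]: "blinfun_apply ?e1 = fst" "blinfun_apply ?e2 = snd"
    by (simp_all add: bounded_linear_Blinfun_apply bounded_linear_fst bounded_linear_snd)
  let ?v' = "\<lambda>z. a z *\<^sub>R ?e1 + b z *\<^sub>R ?e2"
  let ?v'' = "\<lambda>z. (blinfun_scaleR_left ?e1 o\<^sub>L (a1 z *\<^sub>R ?e1 + a2 z *\<^sub>R ?e2))
    + (blinfun_scaleR_left ?e2 o\<^sub>L (b1 z *\<^sub>R ?e1 + b2 z *\<^sub>R ?e2))"
  fix z assume z: "z \<in> S"
  have "blinfun_apply (?v' z) = (\<lambda>h. a z * fst h + b z * snd h)"
    by (auto simp: blinfun.add_left blinfun.scaleR_left)
  then show "(v has_derivative blinfun_apply (?v' z)) (at z within S)" using v[OF z] by simp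
  have "blinfun_apply (?v'' z) = (\<lambda>h. (a1 z * fst h + a2 z * snd h) *\<^sub>R ?e1 + (b1 z * fst h + b2 z * snd h) *\<^sub>R ?e2)"
    by (auto simp: blinfun.add_left blinfun.scaleR_left)
  then show "(?v' has_derivative blinfun_apply (?v'' z)) (at z within S)"
    using has_derivative_add[OF has_derivative_scaleR_left[OF a[OF z], of ?e1] has_derivative_scaleR_left[OF b[OF z], of ?e2]]
    by simp
next
  show "continuous_on S (\<lambda>z. (blinfun_scaleR_left (Blinfun fst :: (real \<times> real) \<Rightarrow>\<^sub>L real)
      o\<^sub>L (a1 z *\<^sub>R Blinfun fst + a2 z *\<^sub>R Blinfun snd))
    + (blinfun_scaleR_left (Blinfun snd :: (real \<times> real) \<Rightarrow>\<^sub>L real)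
      o\<^sub>L (b1 z *\<^sub>R Blinfun fst + b2 z *\<^sub>R Blinfun snd)))"
    by (intro continuous_intros cont)
qed

text \<open>A linear map on the real line is multiplication by its value at 1, which turns the
  operator-valued derivative into a scalar one.\<close>

lemma C2_on_real_UNIV_D:
  fixes K :: "real \<Rightarrow> real"
  assumes "C2_on UNIV K"
  obtains K' where "\<And>y. (K has_real_derivative K' y) (at y)" "continuous_on UNIV K'"
proof -
  obtain F' :: "real \<Rightarrow> real \<Rightarrow>\<^sub>L real" and F'' :: "real \<Rightarrow> real \<Rightarrow>\<^sub>L real \<Rightarrow>\<^sub>L real"
    where F': "\<And>x. (K has_derivative F' x) (at x)"
      and F'': "\<And>x. (F' has_derivative F'' x) (at x)"
    using assms unfolding C2_on_def by auto
  have "(K has_real_derivative F' y 1) (at y)" for y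
  proof -
    have "blinfun_apply (F' y) = (*) (F' y 1)"
    proof
      fix x
      have "F' y (x *\<^sub>R 1) = x *\<^sub>R F' y 1" by (rule blinfun.scaleR_right)
      then show "F' y x = F' y 1 * x" by (simp add: mult.commute)
    qed
    then show ?thesis using F'[of y] by (simp add: has_field_derivative_def)
  qed
  moreover have "continuous_on UNIV (\<lambda>y. F' y 1)"
    by (intro continuous_intros continuous_at_imp_continuous_on ballI has_derivative_continuous[OF F''])
  ultimately show ?thesis by (rule that)
qed

section \<open>Comparison of classical solutions\<close>

text \<open>Sign and concavity of the Hamiltonian are required only for p \<le> 0: for p > 0 it
  comes from an arbitrary extension of the conjugate, about which only continuity of
  \<open>H'\<close> is kept.\<close>

locale hj_strip =
  fixes T c :: real and f f' H H' :: "real \<Rightarrow> real"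
  assumes T_pos: "0 < T"
    and f'_neg: "\<And>u. 0 < u \<Longrightarrow> f' u < 0"
    and f'_cont: "continuous_on {0<..} f'"
    and H'_cont: "continuous_on UNIV H'"
    and H'_zero: "H' 0 = 0"
    and H'_nonneg: "\<And>p. p \<le> 0 \<Longrightarrow> 0 \<le> H' p"
    and H_concave: "\<And>p q. p \<le> 0 \<Longrightarrow> q \<le> 0 \<Longrightarrow> H q \<le> H p + H' p * (q - p)"
begin

text \<open>Here \<open>p\<close> is the space derivative of \<open>v\<close>, and the equation has
  been used to eliminate the time derivative. The last clause is the equation differentiated in u,
  with \<open>r\<close> standing for the space derivative of \<open>p\<close>.\<close>

definition interior_solution :: "(real \<times> real \<Rightarrow> real) \<Rightarrow> (real \<times> real \<Rightarrow> real) \<Rightarrow> bool" where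
  "interior_solution v p \<longleftrightarrow>
    continuous_on ({0..T} \<times> {0..}) v \<and>
    (\<forall>u\<ge>0. v (T, u) = c) \<and>
    (\<forall>t\<in>{0<..<T}. \<forall>u>0.
      (v has_derivative (\<lambda>z. - (f u + H (p (t, u))) * fst z + p (t, u) * snd z)) (at (t, u)) \<and>
      (\<exists>r. (p has_derivative (\<lambda>z. - (f' u + H' (p (t, u)) * r) * fst z + r * snd z)) (at (t, u))))"

lemma interior_solutionD:
  assumes "interior_solution v p"
  shows "continuous_on ({0..T} \<times> {0..}) v"
    and "0 \<le> u \<Longrightarrow> v (T, u) = c"
    and "0 < t \<Longrightarrow> t < T \<Longrightarrow> 0 < u \<Longrightarrow>
      (v has_derivative (\<lambda>z. - (f u + H (p (t, u))) * fst z + p (t, u) * snd z)) (at (t, u))"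
    and "0 < t \<Longrightarrow> t < T \<Longrightarrow> 0 < u \<Longrightarrow>
      \<exists>r. (p has_derivative (\<lambda>z. - (f' u + H' (p (t, u)) * r) * fst z + r * snd z)) (at (t, u))"
  using assms unfolding interior_solution_def by auto

lemma interior_solution_isCont_gradient:
  assumes "interior_solution v p" "0 < t" "t < T" "0 < u"
  shows "isCont p (t, u)"
  using interior_solutionD(4)[OF assms] has_derivative_continuous by blast

text \<open>Since \<open>H' 0 = 0\<close>, the gradient has time derivative \<open>- f' > 0\<close> wherever it vanishes.\<close>

lemma gradient_pos_persists:
  assumes sol: "interior_solution v p" and t: "0 < t" "t \<le> s" "s < T" and u: "0 < u"
    and pos: "0 < p (t, u)"
  shows "0 < p (s, u)"
proof (rule ccontr)
  assume "\<not> 0 < p (s, u)"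
  then have s: "p (s, u) \<le> 0" by simp
  have cont: "continuous_on {t..s} (\<lambda>r. p (r, u))"
  proof (rule continuous_at_imp_continuous_on, safe)
    fix r assume r: "r \<in> {t..s}"
    then have "isCont p (r, u)"
      using interior_solution_isCont_gradient[OF sol] t u by auto
    then show "isCont (\<lambda>r. p (r, u)) r"
      by (intro isCont_o2[where g = p and f = "\<lambda>r. (r, u)"] continuous_intros)
  qed
  \<comment> \<open>The least element of \<open>Z\<close> is the first time at which the gradient is
    no longer positive; by the intermediate value theorem it is a zero.\<close>
  define Z where "Z = {r \<in> {t..s}. p (r, u) \<le> 0}"
  have "compact Z"
    unfolding Z_def compact_eq_bounded_closed
    by (intro conjI continuous_on_closed_Collect_le[OF cont]
        bounded_subset[OF bounded_closed_interval[of t s]]) auto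
  moreover have "Z \<noteq> {}" using s t by (auto simp: Z_def)
  ultimately obtain r where r: "r \<in> Z" "\<And>q. q \<in> Z \<Longrightarrow> r \<le> q"
    using compact_attains_inf by metis
  then have "t \<le> r" "r \<le> s" "p (r, u) \<le> 0" by (auto simp: Z_def)
  then have "t < r" using pos by (cases "t = r") auto
  have zero: "p (r, u) = 0"
  proof (rule ccontr)
    assume "p (r, u) \<noteq> 0"
    then have "\<exists>q\<ge>t. q \<le> r \<and> p (q, u) = 0"
      using \<open>t < r\<close> \<open>r \<le> s\<close> \<open>p (r, u) \<le> 0\<close> pos
      by (intro IVT2'[where f = "\<lambda>r. p (r, u)"] continuous_on_subset[OF cont]) auto
    then obtain q where q: "t \<le> q" "q \<le> r" "p (q, u) = 0" by blast
    then have "q \<in> Z" using \<open>r \<le> s\<close> by (auto simp: Z_def)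
    then have "q = r" using r(2) q(2) by fastforce
    then show False using q(3) \<open>p (r, u) \<noteq> 0\<close> by simp
  qed
  obtain m where "(p has_derivative (\<lambda>z. - (f' u + H' (p (r, u)) * m) * fst z + m * snd z)) (at (r, u))"
    using interior_solutionD(4)[OF sol, of r u] \<open>t < r\<close> \<open>r \<le> s\<close> t u by auto
  from has_real_derivative_partial_fst[OF this]
  have "((\<lambda>q. p (q, u)) has_real_derivative - f' u) (at r)"
    by (simp add: zero H'_zero)
  \<comment> \<open>A positive time derivative at a zero forces negative values just before it,
    hence an earlier element of \<open>Z\<close>.\<close>
  then obtain d where d: "0 < d" "\<And>h. 0 < h \<Longrightarrow> h < d \<Longrightarrow> p (r - h, u) < p (r, u)"
    using DERIV_pos_inc_left[of "\<lambda>q. p (q, u)" "- f' u" r] f'_neg[OF u] by auto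
  define h where "h = min (d / 2) (r - t)"
  have "0 < h" "h < d" "h \<le> r - t" using d \<open>t < r\<close> by (auto simp: h_def min_less_iff_disj)
  then have "p (r - h, u) < 0" using d(2)[of h] zero by simp
  then have "r - h \<in> Z" using \<open>h \<le> r - t\<close> \<open>r \<le> s\<close> \<open>0 < h\<close> by (auto simp: Z_def)
  then show False using r(2)[of "r - h"] \<open>0 < h\<close> by simp
qed

text \<open>Uniform continuity on a compact rectangle provides one time that serves for all u in a
  bounded interval.\<close>

lemma interior_solution_terminal_uniform:
  assumes sol: "interior_solution v p" and "0 < e" "0 \<le> a"
  obtains s where "0 < s" "s < T" "\<And>t u. s \<le> t \<Longrightarrow> t \<le> T \<Longrightarrow> a \<le> u \<Longrightarrow> u \<le> b \<Longrightarrow> \<bar>v (t, u) - c\<bar> < e"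
proof -
  have "uniformly_continuous_on ({0..T} \<times> {a..b}) v"
    using assms(3) interior_solutionD(1)[OF sol]
    by (intro compact_uniformly_continuous compact_Times)
      (auto elim!: continuous_on_subset)
  then obtain d where d: "0 < d"
    "\<And>x y. x \<in> {0..T} \<times> {a..b} \<Longrightarrow> y \<in> {0..T} \<times> {a..b} \<Longrightarrow> dist y x < d \<Longrightarrow> dist (v y) (v x) < e"
    using \<open>0 < e\<close> unfolding uniformly_continuous_on_def by metis
  define s where "s = T - min (d / 2) (T / 2)"
  have s: "0 < s" "s < T" "T - s < d"
    using d(1) T_pos by (auto simp: s_def min_def)
  have "\<bar>v (t, u) - c\<bar> < e" if "s \<le> t" "t \<le> T" "a \<le> u" "u \<le> b" for t u
  proof -
    have "dist (v (t, u)) (v (T, u)) < e"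
      using that s by (intro d(2)) (auto simp: dist_Pair_Pair dist_real_def)
    then show ?thesis
      using interior_solutionD(2)[OF sol, of u] that assms(3) by (simp add: dist_real_def)
  qed
  with s(1,2) show ?thesis using that by blast
qed


text \<open>
  If the gradient is positive near a point, it stays positive until the terminal time, where it
  tends to \<open>0\<close> in mean on an interval; but a small gradient \<open>\<epsilon>\<close> cannot have stayed positive, as going
  back in time it decreases at a definite rate while moving with bounded speed. The function
  minimised below is a barrier for this statement.
\<close>

lemma gradient_nonpos:
  assumes sol: "interior_solution v p" and t0: "0 < t\<^sub>0" "t\<^sub>0 < T" and u0: "0 < u\<^sub>0"
  shows "p (t\<^sub>0, u\<^sub>0) \<le> 0"
proof (rule ccontr)
  assume "\<not> p (t\<^sub>0, u\<^sub>0) \<le> 0"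
  then have pos0: "0 < p (t\<^sub>0, u\<^sub>0)" by simp
  have "isCont p (t\<^sub>0, u\<^sub>0)"
    using interior_solution_isCont_gradient[OF sol] t0 u0 by blast
  then obtain d where d: "0 < d"
    "\<And>z. dist z (t\<^sub>0, u\<^sub>0) < d \<Longrightarrow> dist (p z) (p (t\<^sub>0, u\<^sub>0)) < p (t\<^sub>0, u\<^sub>0)"
    using pos0 unfolding continuous_at_eps_delta by metis
  \<comment> \<open>The interval \<open>{a..b}\<close> consists of three pieces of length
    \<open>l\<close>: the mean value theorem is applied on the middle one, and the outer ones keep
    the minimiser off the lateral sides.\<close>
  define l where "l = d / 6"
  define a where "a = u\<^sub>0"
  define b where "b = u\<^sub>0 + 3 * l"
  have l: "0 < l" and a: "0 < a" and b: "b = a + 3 * l"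
    using d u0 by (auto simp: l_def a_def b_def)
  have "0 < p (t\<^sub>0, u)" if "a \<le> u" "u \<le> b" for u
  proof -
    have "dist (p (t\<^sub>0, u)) (p (t\<^sub>0, u\<^sub>0)) < p (t\<^sub>0, u\<^sub>0)"
      using that d(1) by (intro d(2)) (auto simp: a_def b_def l_def dist_Pair_Pair dist_real_def)
    then show ?thesis by (auto simp: dist_real_def)
  qed
  then have pos: "0 < p (t, u)" if "a \<le> u" "u \<le> b" "t\<^sub>0 \<le> t" "t < T" for t u
    using gradient_pos_persists[OF sol, of t\<^sub>0 t u] that a t0 by auto
  have "continuous_on {a..b} f'"
    using a by (auto intro: continuous_on_subset[OF f'_cont])
  then obtain u' where u': "u' \<in> {a..b}" "\<And>u. u \<in> {a..b} \<Longrightarrow> f' u \<le> f' u'"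
    using continuous_attains_sup[of "{a..b}" f'] l b by auto
  define m where "m = - f' u'"
  have m: "0 < m" "\<And>u. a \<le> u \<Longrightarrow> u \<le> b \<Longrightarrow> m \<le> - f' u"
    using u' a f'_neg[of u'] by (auto simp: m_def)
  have "compact (H' ` {0..1})"
    by (intro compact_continuous_image continuous_on_subset[OF H'_cont]) auto
  then obtain M where M: "0 < M" "\<And>q. 0 \<le> q \<Longrightarrow> q \<le> 1 \<Longrightarrow> \<bar>H' q\<bar> \<le> M"
    using compact_imp_bounded bounded_pos by (metis atLeastAtMost_iff imageI real_norm_def)
  \<comment> \<open>The bound 1 keeps \<open>p\<close> in the range where \<open>M\<close> controls
    \<open>H'\<close>; the second bound excludes a minimiser at time \<open>t\<^sub>0\<close>; the
    third makes the transport term smaller than \<open>m / 2\<close>.\<close>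
  define e where "e = min 1 (min (m * (T - t\<^sub>0) / 4) (m * l / (36 * M)))"
  have e: "0 < e" "e \<le> 1" "e \<le> m * (T - t\<^sub>0) / 4" "e \<le> m * l / (36 * M)"
    using m M l t0 by (auto simp: e_def)
  have "0 < l * e / 4" using l e by simp
  then obtain s\<^sub>1 where s1: "0 < s\<^sub>1" "s\<^sub>1 < T"
    "\<And>t u. s\<^sub>1 \<le> t \<Longrightarrow> t \<le> T \<Longrightarrow> a \<le> u \<Longrightarrow> u \<le> b \<Longrightarrow> \<bar>v (t, u) - c\<bar> < l * e / 4"
    using interior_solution_terminal_uniform[OF sol, of "l * e / 4" a b] a by (metis less_imp_le)
  \<comment> \<open>The midpoint ensures that at least half of the time from
    \<open>t\<^sub>0\<close> to \<open>T\<close> is available to the barrier.\<close>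
  define s where "s = max s\<^sub>1 ((T + t\<^sub>0) / 2)"
  have s: "s\<^sub>1 \<le> s" "s < T" "t\<^sub>0 < s" "(T - t\<^sub>0) / 2 \<le> s - t\<^sub>0"
    using s1 t0 by (auto simp: s_def max_def field_simps)
  \<comment> \<open>Near the terminal time \<open>v\<close> is almost constant in u, so its slope is
    below \<open>e\<close> at some point of the middle piece.\<close>
  have "\<exists>u>a + l. u < b - l \<and> v (s, b - l) - v (s, a + l) = (b - l - (a + l)) * p (s, u)"
  proof (rule MVT2)
    fix u assume "a + l \<le> u" "u \<le> b - l"
    then show "((\<lambda>u. v (s, u)) has_real_derivative p (s, u)) (at u)"
      using a l b s t0 by (intro has_real_derivative_partial_snd[OF interior_solutionD(3)[OF sol]]) auto
  qed (use l b in auto)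
  then obtain u\<^sub>1 where u1: "a + l < u\<^sub>1" "u\<^sub>1 < b - l"
    and mvt: "v (s, b - l) - v (s, a + l) = l * p (s, u\<^sub>1)"
    by (auto simp: b)
  have "\<bar>v (s, b - l) - c\<bar> < l * e / 4" "\<bar>v (s, a + l) - c\<bar> < l * e / 4"
    using s l b by (intro s1(3); linarith)+
  then have "l * p (s, u\<^sub>1) < l * e" using mvt \<open>0 < l * e / 4\<close> by linarith
  then have pe: "p (s, u\<^sub>1) < e" using l by simp
  \<comment> \<open>The parabola reaches \<open>2 * e\<close> at distance \<open>l\<close> from
    \<open>u\<^sub>1\<close>, while the minimum of \<open>G\<close> is below \<open>e\<close>
    because \<open>G (s, u\<^sub>1) = p (s, u\<^sub>1)\<close>.\<close>
  define A where "A = 2 * e / l\<^sup>2"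
  have A: "0 < A" "A * l\<^sup>2 = 2 * e" using e l by (auto simp: A_def)
  define G where "G = (\<lambda>z. p z + A * (snd z - u\<^sub>1)\<^sup>2 + m / 2 * (s - fst z))"
  have "continuous_on ({t\<^sub>0..s} \<times> {a..b}) p"
    using interior_solution_isCont_gradient[OF sol] t0 s a
    by (intro continuous_at_imp_continuous_on) auto
  then have "continuous_on ({t\<^sub>0..s} \<times> {a..b}) G"
    unfolding G_def by (intro continuous_intros)
  moreover have "compact ({t\<^sub>0..s} \<times> {a..b})" by (intro compact_Times) auto
  moreover have "{t\<^sub>0..s} \<times> {a..b} \<noteq> {}" using s l b by auto
  ultimately obtain z where z: "z \<in> {t\<^sub>0..s} \<times> {a..b}" "\<And>x. x \<in> {t\<^sub>0..s} \<times> {a..b} \<Longrightarrow> G z \<le> G x"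
    using continuous_attains_inf by metis
  obtain t u where tu: "z = (t, u)" by fastforce
  have t: "t\<^sub>0 \<le> t" "t \<le> s" and u: "a \<le> u" "u \<le> b" using z tu by auto
  have min: "G (t, u) \<le> G (t', w)" if "t\<^sub>0 \<le> t'" "t' \<le> s" "a \<le> w" "w \<le> b" for t' w
    using z(2)[of "(t', w)"] that tu by auto
  have "G (t, u) \<le> G (s, u\<^sub>1)" using s u1 l by (intro min) auto
  then have Ge: "G (t, u) < e" using pe by (simp add: G_def)
  have ppos: "0 < p (t, u)" using pos t u s by simp
  have "0 \<le> A * (u - u\<^sub>1)\<^sup>2" "0 \<le> m / 2 * (s - t)" using A m t by auto
  then have parts: "p (t, u) < e" "A * (u - u\<^sub>1)\<^sup>2 < e" "m / 2 * (s - t) < e"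
    using Ge ppos by (auto simp: G_def)
  have "\<bar>u - u\<^sub>1\<bar> < l"
  proof (rule ccontr)
    assume "\<not> \<bar>u - u\<^sub>1\<bar> < l"
    then have "l\<^sup>2 \<le> (u - u\<^sub>1)\<^sup>2" using l by (intro abs_le_square_iff[THEN iffD1]) auto
    then have "A * l\<^sup>2 \<le> A * (u - u\<^sub>1)\<^sup>2" using A(1) by (intro mult_left_mono) auto
    then show False using parts A e by linarith
  qed
  then have u_in: "a < u" "u < b" using u1 by auto
  have "t \<noteq> t\<^sub>0"
  proof
    assume "t = t\<^sub>0"
    then have "m / 2 * ((T - t\<^sub>0) / 2) \<le> m / 2 * (s - t)" using s m by (intro mult_left_mono) auto
    then show False using parts e by simp
  qed
  then have t_in: "t\<^sub>0 < t" using t by simp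
  obtain r where r: "(p has_derivative (\<lambda>z. - (f' u + H' (p (t, u)) * r) * fst z + r * snd z)) (at (t, u))"
    using interior_solutionD(4)[OF sol, of t u] t_in t0 t s a u by auto
  \<comment> \<open>The minimiser is interior in u, so the first-order condition expresses the
    unknown \<open>r\<close> through its distance from \<open>u\<^sub>1\<close>.\<close>
  have "((\<lambda>w. G (t, w)) has_real_derivative r + A * (2 * (u - u\<^sub>1))) (at u)"
    unfolding G_def fst_conv snd_conv
    by (rule derivative_eq_intros has_real_derivative_partial_snd[OF r] refl)+ (simp)
  then have "r + A * (2 * (u - u\<^sub>1)) = 0"
  proof (rule DERIV_local_min[where d = "min (u - a) (b - u)"])
    show "0 < min (u - a) (b - u)" using u_in by simp
    show "\<forall>w. \<bar>u - w\<bar> < min (u - a) (b - u) \<longrightarrow> G (t, u) \<le> G (t, w)"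
      using t by (auto intro!: min)
  qed
  then have "r = - (2 * A) * (u - u\<^sub>1)" by (simp add: algebra_simps)
  then have "\<bar>r\<bar> = 2 * A * \<bar>u - u\<^sub>1\<bar>" using A by (simp only: abs_mult)
  also have "\<dots> \<le> 2 * A * (3 * l)"
    using A \<open>\<bar>u - u\<^sub>1\<bar> < l\<close> l by (intro mult_left_mono) auto
  also have "\<dots> = 12 * e / l" using l by (simp add: A_def field_simps power2_eq_square)
  finally have "\<bar>H' (p (t, u))\<bar> * \<bar>r\<bar> \<le> M * (12 * e / l)"
    using M ppos parts e by (intro mult_mono) auto
  also have "\<dots> \<le> M * (12 * (m * l / (36 * M)) / l)"
    using e M l by (intro mult_left_mono divide_right_mono) auto
  also have "\<dots> < m / 2" using M l m by (simp add: field_simps)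
  finally have "\<bar>H' (p (t, u)) * r\<bar> < m / 2" by (simp add: abs_mult)
  then have pt: "0 < - (f' u + H' (p (t, u)) * r) - m / 2" using m(2)[OF u] by linarith
  \<comment> \<open>The minimiser may lie at the final time \<open>s\<close>, so only earlier times
    are compared: \<open>G\<close> increases in time there and is smaller just before.\<close>
  have "((\<lambda>q. G (q, u)) has_real_derivative - (f' u + H' (p (t, u)) * r) - m / 2) (at t)"
    unfolding G_def fst_conv snd_conv
    by (rule derivative_eq_intros has_real_derivative_partial_fst[OF r] refl)+ (simp)
  from DERIV_pos_inc_left[OF this pt] obtain \<delta> where \<delta>: "0 < \<delta>"
    "\<And>h. 0 < h \<Longrightarrow> h < \<delta> \<Longrightarrow> G (t - h, u) < G (t, u)" by auto
  define h where "h = min (\<delta> / 2) (t - t\<^sub>0)"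
  have "0 < h" "h < \<delta>" "h \<le> t - t\<^sub>0" using \<delta> t_in by (auto simp: h_def min_less_iff_disj)
  then show False using \<delta>(2)[of h] min[of "t - h" u] t u by simp
qed

text \<open>
  By concavity of \<open>H\<close>, the difference \<open>v\<^sub>1 - v\<^sub>2\<close> does not decrease to first order in the
  direction of the characteristics \<open>u' = H' p\<^sub>2\<close> of \<open>v\<^sub>2\<close>, along which \<open>p\<^sub>2\<close> increases and hence the
  speed stays bounded. A point of the set \<open>C\<close> with maximal time can therefore be moved further.
\<close>

lemma interior_solution_le:
  assumes sol1: "interior_solution v\<^sub>1 p\<^sub>1" and sol2: "interior_solution v\<^sub>2 p\<^sub>2"
    and t0: "0 < t\<^sub>0" "t\<^sub>0 < T" and u0: "0 < u\<^sub>0"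
  shows "v\<^sub>1 (t\<^sub>0, u\<^sub>0) \<le> v\<^sub>2 (t\<^sub>0, u\<^sub>0)"
proof (rule ccontr)
  define Z where "Z = (\<lambda>z. v\<^sub>1 z - v\<^sub>2 z)"
  define z\<^sub>0 where "z\<^sub>0 = Z (t\<^sub>0, u\<^sub>0)"
  assume "\<not> v\<^sub>1 (t\<^sub>0, u\<^sub>0) \<le> v\<^sub>2 (t\<^sub>0, u\<^sub>0)"
  then have z0: "0 < z\<^sub>0" by (simp add: z\<^sub>0_def Z_def)
  \<comment> \<open>A loss of \<open>e\<close> per unit time over the whole strip consumes at most
    half of the initial gap \<open>z\<^sub>0\<close>.\<close>
  define e where "e = z\<^sub>0 / (2 * T)"
  have e: "0 < e" "e * T = z\<^sub>0 / 2" using z0 T_pos by (auto simp: e_def)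
  \<comment> \<open>On the set \<open>C\<close> below, \<open>p\<^sub>2\<close> lies between
    \<open>P\<close> and 0, so \<open>L\<close> bounds the speed there; \<open>R\<close> is the
    furthest position that this speed allows before \<open>T\<close>.\<close>
  define P where "P = p\<^sub>2 (t\<^sub>0, u\<^sub>0)"
  have "compact (H' ` {P..0})"
    by (intro compact_continuous_image continuous_on_subset[OF H'_cont]) auto
  then obtain L where L: "0 < L" "\<And>q. P \<le> q \<Longrightarrow> q \<le> 0 \<Longrightarrow> \<bar>H' q\<bar> \<le> L"
    using compact_imp_bounded bounded_pos by (metis atLeastAtMost_iff imageI real_norm_def)
  define R where "R = u\<^sub>0 + L * T"
  obtain s\<^sub>1 where s1: "0 < s\<^sub>1" "s\<^sub>1 < T"
    "\<And>t u. s\<^sub>1 \<le> t \<Longrightarrow> t \<le> T \<Longrightarrow> u\<^sub>0 \<le> u \<Longrightarrow> u \<le> R \<Longrightarrow> \<bar>v\<^sub>1 (t, u) - c\<bar> < z\<^sub>0 / 4"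
    using interior_solution_terminal_uniform[OF sol1, of "z\<^sub>0 / 4" u\<^sub>0 R] z0 u0 by auto
  obtain s\<^sub>2 where s2: "0 < s\<^sub>2" "s\<^sub>2 < T"
    "\<And>t u. s\<^sub>2 \<le> t \<Longrightarrow> t \<le> T \<Longrightarrow> u\<^sub>0 \<le> u \<Longrightarrow> u \<le> R \<Longrightarrow> \<bar>v\<^sub>2 (t, u) - c\<bar> < z\<^sub>0 / 4"
    using interior_solution_terminal_uniform[OF sol2, of "z\<^sub>0 / 4" u\<^sub>0 R] z0 u0 by auto
  define s where "s = max s\<^sub>1 s\<^sub>2"
  have s: "0 < s" "s < T" "s\<^sub>1 \<le> s" "s\<^sub>2 \<le> s" using s1 s2 by (auto simp: s_def)
  have Zsmall: "Z (t, u) < z\<^sub>0 / 2" if "s \<le> t" "t \<le> T" "u\<^sub>0 \<le> u" "u \<le> R" for t u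
  proof -
    have "\<bar>v\<^sub>1 (t, u) - c\<bar> < z\<^sub>0 / 4" "\<bar>v\<^sub>2 (t, u) - c\<bar> < z\<^sub>0 / 4"
      using that s by (intro s1(3) s2(3); linarith)+
    then show ?thesis unfolding Z_def by linarith
  qed
  have Zbig: "z\<^sub>0 / 2 \<le> z\<^sub>0 - e * (t - t\<^sub>0)" if "t \<le> T" for t
  proof -
    have "e * (t - t\<^sub>0) \<le> e * T" using that t0 e by (intro mult_left_mono) auto
    then show ?thesis using e by simp
  qed
  have t0s: "t\<^sub>0 < s"
  proof (rule ccontr)
    assume "\<not> t\<^sub>0 < s"
    then have "Z (t\<^sub>0, u\<^sub>0) < z\<^sub>0 / 2" using t0 L T_pos by (intro Zsmall) (auto simp: R_def)
    then show False using z0 by (simp add: z\<^sub>0_def)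
  qed
  define D where "D = {t\<^sub>0..s} \<times> {u\<^sub>0..R}"
  \<comment> \<open>Compactness of \<open>C\<close> replaces solving the characteristic equation.
    Its conditions are those preserved by a short step along a characteristic: small loss of
    \<open>Z\<close>, gradient at least \<open>P\<close>, speed at most \<open>L\<close>.\<close>
  define C where "C = {z \<in> D. z\<^sub>0 - e * (fst z - t\<^sub>0) \<le> Z z} \<inter> {z \<in> D. P \<le> p\<^sub>2 z} \<inter>
    {z \<in> D. snd z \<le> u\<^sub>0 + L * (fst z - t\<^sub>0)}"
  have "closed D" "compact D" unfolding D_def by (auto intro: closed_Times compact_Times)
  have "continuous_on D v\<^sub>1" "continuous_on D v\<^sub>2"
    using interior_solutionD(1)[OF sol1] interior_solutionD(1)[OF sol2] s t0 u0
    unfolding D_def by (auto elim!: continuous_on_subset)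
  then have contZ: "continuous_on D Z" unfolding Z_def by (intro continuous_intros)
  have contp: "continuous_on D p\<^sub>2"
    using interior_solution_isCont_gradient[OF sol2] t0 u0 s
    by (intro continuous_at_imp_continuous_on) (auto simp: D_def)
  have "closed C"
    unfolding C_def using \<open>closed D\<close>
    by (intro closed_Int continuous_on_closed_Collect_le contZ contp continuous_intros)
  with \<open>compact D\<close> have "compact (D \<inter> C)" by (rule compact_Int_closed)
  moreover have "D \<inter> C = C" by (auto simp: C_def)
  ultimately have "compact C" by simp
  then have "compact (fst ` C)" by (intro compact_continuous_image continuous_intros)
  moreover have "(t\<^sub>0, u\<^sub>0) \<in> C"
    using t0s L T_pos by (auto simp: C_def D_def R_def z\<^sub>0_def P_def)
  ultimately obtain z where z: "z \<in> C" "\<And>x. x \<in> C \<Longrightarrow> fst x \<le> fst z"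
    using compact_attains_sup[of "fst ` C"] by blast
  obtain t u where tu: "z = (t, u)" by fastforce
  have t: "t\<^sub>0 \<le> t" "t \<le> s" and u: "u\<^sub>0 \<le> u" "u \<le> R" "u \<le> u\<^sub>0 + L * (t - t\<^sub>0)"
    and Zt: "z\<^sub>0 - e * (t - t\<^sub>0) \<le> Z (t, u)" and Pt: "P \<le> p\<^sub>2 (t, u)"
    using z(1) tu by (auto simp: C_def D_def)
  have "t \<noteq> s" using Zsmall[of t u] Zbig[of t] Zt u s by auto
  then have ts: "t < s" using t by simp
  have dom: "0 < t" "t < T" "0 < u" using t t0 s u u0 by auto
  have np: "p\<^sub>1 (t, u) \<le> 0" "p\<^sub>2 (t, u) \<le> 0"
    using gradient_nonpos[OF sol1 dom] gradient_nonpos[OF sol2 dom] by auto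
  define q where "q = H' (p\<^sub>2 (t, u))"
  have q: "0 \<le> q" "q \<le> L" using H'_nonneg[OF np(2)] L(2)[OF Pt np(2)] by (auto simp: q_def)
  have v1': "((\<lambda>h. v\<^sub>1 (t + h, u + q * h)) has_real_derivative
      - (f u + H (p\<^sub>1 (t, u))) * 1 + p\<^sub>1 (t, u) * q) (at 0)"
    by (rule has_real_derivative_compose_pair)
      (use interior_solutionD(3)[OF sol1 dom] in \<open>auto intro!: derivative_eq_intros\<close>)
  have v2': "((\<lambda>h. v\<^sub>2 (t + h, u + q * h)) has_real_derivative
      - (f u + H (p\<^sub>2 (t, u))) * 1 + p\<^sub>2 (t, u) * q) (at 0)"
    by (rule has_real_derivative_compose_pair)
      (use interior_solutionD(3)[OF sol2 dom] in \<open>auto intro!: derivative_eq_intros\<close>)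
  obtain r where r: "(p\<^sub>2 has_derivative (\<lambda>z. - (f' u + H' (p\<^sub>2 (t, u)) * r) * fst z + r * snd z)) (at (t, u))"
    using interior_solutionD(4)[OF sol2 dom] by auto
  have "((\<lambda>h. p\<^sub>2 (t + h, u + q * h)) has_real_derivative
      - (f' u + H' (p\<^sub>2 (t, u)) * r) * 1 + r * q) (at 0)"
    by (rule has_real_derivative_compose_pair) (use r in \<open>auto intro!: derivative_eq_intros\<close>)
  \<comment> \<open>With \<open>q = H' (p\<^sub>2 (t, u))\<close> the unknown \<open>r\<close>
    cancels, and what remains is positive.\<close>
  then have p2': "((\<lambda>h. p\<^sub>2 (t + h, u + q * h)) has_real_derivative - f' u) (at 0)"
    by (simp add: q_def algebra_simps)
  \<comment> \<open>Concavity makes the derivative of \<open>Z\<close> in this direction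
    nonnegative; the term \<open>e * h\<close> turns this into a strict increase.\<close>
  have "H (p\<^sub>1 (t, u)) \<le> H (p\<^sub>2 (t, u)) + q * (p\<^sub>1 (t, u) - p\<^sub>2 (t, u))"
    unfolding q_def using H_concave np by blast
  then have "0 < (- (f u + H (p\<^sub>1 (t, u))) * 1 + p\<^sub>1 (t, u) * q)
      - (- (f u + H (p\<^sub>2 (t, u))) * 1 + p\<^sub>2 (t, u) * q) + e * 1"
    using e by (simp add: algebra_simps)
  moreover have "((\<lambda>h. Z (t + h, u + q * h) + e * h) has_real_derivative
      (- (f u + H (p\<^sub>1 (t, u))) * 1 + p\<^sub>1 (t, u) * q)
      - (- (f u + H (p\<^sub>2 (t, u))) * 1 + p\<^sub>2 (t, u) * q) + e * 1) (at 0)"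
    unfolding Z_def by (intro DERIV_add DERIV_diff v1' v2' DERIV_cmult DERIV_ident)
  ultimately obtain d1 where d1: "0 < d1"
    "\<And>h. 0 < h \<Longrightarrow> h < d1 \<Longrightarrow> Z (t, u) < Z (t + h, u + q * h) + e * h"
    using DERIV_pos_inc_right[of "\<lambda>h. Z (t + h, u + q * h) + e * h" _ 0] by auto
  obtain d2 where d2: "0 < d2"
    "\<And>h. 0 < h \<Longrightarrow> h < d2 \<Longrightarrow> p\<^sub>2 (t, u) < p\<^sub>2 (t + h, u + q * h)"
    using DERIV_pos_inc_right[OF p2'] f'_neg[OF dom(3)] by auto
  define h where "h = min (s - t) (min d1 d2 / 2)"
  have h: "0 < h" "h < d1" "h < d2" "h \<le> s - t"
    using d1 d2 ts by (auto simp: h_def min_def)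
  have "u + q * h \<le> u\<^sub>0 + L * (t - t\<^sub>0) + L * h"
    using u(3) q h by (intro add_mono mult_right_mono) auto
  then have uh: "u + q * h \<le> u\<^sub>0 + L * (t + h - t\<^sub>0)" by (simp add: algebra_simps)
  also have "\<dots> \<le> R" unfolding R_def using L h s t0 by (intro add_left_mono mult_left_mono) auto
  finally have "(t + h, u + q * h) \<in> C"
    using uh h t u q d1(2)[of h] d2(2)[of h] Zt Pt
    by (auto simp: C_def D_def algebra_simps add_increasing2)
  then show False using z(2)[of "(t + h, u + q * h)"] tu h by simp
qed

text \<open>Comparison in both directions on the open strip extends to its closure by
  continuity.\<close>

lemma interior_solution_unique:
  assumes sol1: "interior_solution v\<^sub>1 p\<^sub>1" and sol2: "interior_solution v\<^sub>2 p\<^sub>2"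
    and z: "z \<in> {0..T} \<times> {0..}"
  shows "v\<^sub>1 z = v\<^sub>2 z"
proof -
  have cl: "closure ({0<..<T} \<times> {0::real<..}) = {0..T} \<times> {0..}"
    using T_pos by (simp add: closure_Times)
  have le: "v z - w z \<le> 0" if "interior_solution v p" "interior_solution w q" for v p w q
  proof (rule continuous_le_on_closure[where S = "{0<..<T} \<times> {0<..}" and f = "\<lambda>z. v z - w z"])
    show "continuous_on (closure ({0<..<T} \<times> {0<..})) (\<lambda>z. v z - w z)"
      unfolding cl by (intro continuous_intros interior_solutionD(1)[OF that(1)] interior_solutionD(1)[OF that(2)])
    show "z \<in> closure ({0<..<T} \<times> {0<..})" using z cl by simp
    show "v x - w x \<le> 0" if "x \<in> {0<..<T} \<times> {0<..}" for x
      using that interior_solution_le[OF \<open>interior_solution v p\<close> \<open>interior_solution w q\<close>] by auto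
  qed
  show ?thesis using le[OF sol1 sol2] le[OF sol2 sol1] by simp
qed

text \<open>Inside the strip the relative and one-sided derivatives are ordinary ones.
  Differentiating the equation in u and interchanging the mixed partials yields the time derivative
  of the gradient.\<close>

lemma interior_solutionI:
  assumes v: "continuous_on ({0..T} \<times> {0..}) v" "\<And>u. 0 \<le> u \<Longrightarrow> v (T, u) = c"
    and C2: "C2_on ({0..<T} \<times> {0..}) v"
    and pde: "\<And>t u. 0 < t \<Longrightarrow> t < T \<Longrightarrow> 0 < u \<Longrightarrow> D_t T v t u + f u + H (D_u v t u) = 0"
    and f: "\<And>u. 0 < u \<Longrightarrow> (f has_real_derivative f' u) (at u)"
    and H: "\<And>p. (H has_real_derivative H' p) (at p)"
  shows "interior_solution v (\<lambda>z. D_u v (fst z) (snd z))"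
proof -
  let ?S = "{0..<T} \<times> {0::real..}"
  define \<Omega> where "\<Omega> = {0<..<T} \<times> {0::real<..}"
  have \<Omega>: "open \<Omega>" by (simp add: \<Omega>_def open_Times)
  have in\<Omega>: "(t, u) \<in> \<Omega> \<longleftrightarrow> 0 < t \<and> t < T \<and> 0 < u" for t u by (auto simp: \<Omega>_def)
  have at: "at z within ?S = at z" if "z \<in> \<Omega>" for z
    using that \<Omega> by (intro at_within_interior) (auto simp: \<Omega>_def interior_Times intro!: interiorI[OF \<Omega>])
  obtain F' :: "real \<times> real \<Rightarrow> (real \<times> real) \<Rightarrow>\<^sub>L real"
    and F'' :: "real \<times> real \<Rightarrow> (real \<times> real) \<Rightarrow>\<^sub>L (real \<times> real) \<Rightarrow>\<^sub>L real"
    where F': "\<And>z. z \<in> ?S \<Longrightarrow> (v has_derivative F' z) (at z within ?S)"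
      and F'': "\<And>z. z \<in> ?S \<Longrightarrow> (F' has_derivative F'' z) (at z within ?S)"
      and F''_cont: "continuous_on ?S F''"
    using C2 unfolding C2_on_def by blast
  define a where "a = (\<lambda>z. F' z (1, 0))"
  define b where "b = (\<lambda>z. F' z (0, 1))"
  have lin: "L d = L (1, 0) * fst d + L (0, 1) * snd d" if "linear L" for L :: "real \<times> real \<Rightarrow> real" and d
  proof -
    have "L d = L (fst d *\<^sub>R (1, 0) + snd d *\<^sub>R (0, 1))" by simp
    also have "\<dots> = L (1, 0) * fst d + L (0, 1) * snd d"
      using that by (simp only: linear_add linear_scale) simp
    finally show ?thesis .
  qed
  have sub: "z \<in> ?S" if "z \<in> \<Omega>" for z using that by (auto simp: \<Omega>_def)
  have v': "(v has_derivative (\<lambda>d. a z * fst d + b z * snd d)) (at z)" if "z \<in> \<Omega>" for z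
  proof -
    have "blinfun_apply (F' z) = (\<lambda>d. a z * fst d + b z * snd d)"
      unfolding a_def b_def by (rule ext, rule lin) (simp add: blinfun.bounded_linear_right bounded_linear.linear)
    then show ?thesis using F'[OF sub[OF that]] at[OF that] by simp
  qed
  have comp: "((\<lambda>z. F' z w) has_derivative (\<lambda>d. F'' z (1, 0) w * fst d + F'' z (0, 1) w * snd d)) (at z)"
    if "z \<in> \<Omega>" for z w
  proof -
    have "((\<lambda>z. F' z w) has_derivative (\<lambda>d. F'' z d w)) (at z)"
      using bounded_linear.has_derivative[OF blinfun.bounded_linear_left F''[OF sub[OF that]], of w]
        at[OF that] by simp
    moreover have "(\<lambda>d. F'' z d w) = (\<lambda>d. F'' z (1, 0) w * fst d + F'' z (0, 1) w * snd d)"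
      by (rule ext, rule lin)
        (auto intro!: bounded_linear.linear bounded_linear_compose[OF blinfun.bounded_linear_left]
          blinfun.bounded_linear_right)
    ultimately show ?thesis by simp
  qed
  have Dt: "D_t T v t u = a (t, u)" if "(t, u) \<in> \<Omega>" for t u
  proof -
    have "at t within {0..<T} = at t" using that by (intro at_within_interior) (auto simp: in\<Omega>)
    then show ?thesis
      unfolding D_t_def using has_real_derivative_partial_fst[OF v'[OF that]]
      by (simp add: vector_derivative_at has_real_derivative_iff_has_vector_derivative)
  qed
  have Du: "D_u v t u = b (t, u)" if "(t, u) \<in> \<Omega>" for t u
  proof -
    have "at u within {0..} = at u" using that by (intro at_within_interior) (auto simp: in\<Omega>)
    then show ?thesis
      unfolding D_u_def using has_real_derivative_partial_snd[OF v'[OF that]]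
      by (simp add: vector_derivative_at has_real_derivative_iff_has_vector_derivative)
  qed
  have a_eq: "a (t, u) = - (f u + H (b (t, u)))" if "(t, u) \<in> \<Omega>" for t u
    using pde[of t u] Dt[OF that] Du[OF that] that by (simp add: in\<Omega>)
  have F''c: "isCont (\<lambda>z. F'' z w w') z" if "z \<in> \<Omega>" for z w w'
  proof -
    have "continuous_on \<Omega> (\<lambda>z. F'' z w w')"
      by (intro continuous_intros continuous_on_subset[OF F''_cont]) (use sub in auto)
    then show ?thesis using that \<Omega> by (simp add: continuous_on_eq_continuous_at)
  qed
  have main: "(v has_derivative (\<lambda>z. - (f u + H (D_u v t u)) * fst z + D_u v t u * snd z)) (at (t, u)) \<and>
      (\<exists>r. ((\<lambda>z. D_u v (fst z) (snd z)) has_derivative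
        (\<lambda>z. - (f' u + H' (D_u v t u) * r) * fst z + r * snd z)) (at (t, u)))"
    if tu: "(t, u) \<in> \<Omega>" for t u
  proof (intro conjI exI)
    show "(v has_derivative (\<lambda>z. - (f u + H (D_u v t u)) * fst z + D_u v t u * snd z)) (at (t, u))"
      using v'[OF tu] a_eq[OF tu] Du[OF tu] by simp
    define r where "r = F'' (t, u) (0, 1) (0, 1)"
    have mixed: "F'' (t, u) (0, 1) (1, 0) = F'' (t, u) (1, 0) (0, 1)"
    proof (rule mixed_partials_eq[OF \<Omega> tu, where f = v and a = a and b = b
          and ?a2.0 = "\<lambda>z. F'' z (0, 1) (1, 0)" and ?b1.0 = "\<lambda>z. F'' z (1, 0) (0, 1)"])
      fix s w assume sw: "(s, w) \<in> \<Omega>"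
      show "((\<lambda>s. v (s, w)) has_real_derivative a (s, w)) (at s)"
        by (rule has_real_derivative_partial_fst[OF v'[OF sw]])
      show "((\<lambda>w. v (s, w)) has_real_derivative b (s, w)) (at w)"
        by (rule has_real_derivative_partial_snd[OF v'[OF sw]])
      show "((\<lambda>w. a (s, w)) has_real_derivative F'' (s, w) (0, 1) (1, 0)) (at w)"
        unfolding a_def by (rule has_real_derivative_partial_snd[OF comp[OF sw]])
      show "((\<lambda>s. b (s, w)) has_real_derivative F'' (s, w) (1, 0) (0, 1)) (at s)"
        unfolding b_def by (rule has_real_derivative_partial_fst[OF comp[OF sw]])
    qed (use F''c[OF tu] in auto)
    have u: "0 < u" using tu in\<Omega> by simp
    have bu: "((\<lambda>w. b (t, w)) has_real_derivative r) (at u)"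
      unfolding b_def r_def by (rule has_real_derivative_partial_snd[OF comp[OF tu]])
    have "((\<lambda>w. - (f w + H (b (t, w)))) has_real_derivative - (f' u + H' (b (t, u)) * r)) (at u)"
      by (intro DERIV_minus DERIV_add f[OF u] DERIV_chain2[OF H bu])
    moreover have "eventually (\<lambda>w. w \<in> {0<..}) (nhds u)"
      using u by (intro eventually_nhds_in_open) auto
    then have "eventually (\<lambda>w. - (f w + H (b (t, w))) = a (t, w)) (nhds u)"
      by eventually_elim (use a_eq tu in\<Omega> in auto)
    ultimately have "((\<lambda>w. a (t, w)) has_real_derivative - (f' u + H' (b (t, u)) * r)) (at u)"
      by (rule DERIV_cong_ev[OF refl _ refl, THEN iffD1, rotated])
    moreover have "((\<lambda>w. a (t, w)) has_real_derivative F'' (t, u) (0, 1) (1, 0)) (at u)"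
      unfolding a_def by (rule has_real_derivative_partial_snd[OF comp[OF tu]])
    ultimately have "F'' (t, u) (1, 0) (0, 1) = - (f' u + H' (b (t, u)) * r)"
      using DERIV_unique mixed by metis
    then have "(b has_derivative (\<lambda>z. - (f' u + H' (b (t, u)) * r) * fst z + r * snd z)) (at (t, u))"
      using comp[OF tu, of "(0, 1)"] by (simp add: b_def r_def)
    then have "((\<lambda>z. D_u v (fst z) (snd z)) has_derivative
        (\<lambda>z. - (f' u + H' (b (t, u)) * r) * fst z + r * snd z)) (at (t, u))"
      by (rule has_derivative_transform_within_open[OF _ \<Omega> tu]) (auto simp: Du)
    then show "((\<lambda>z. D_u v (fst z) (snd z)) has_derivative
        (\<lambda>z. - (f' u + H' (D_u v t u) * r) * fst z + r * snd z)) (at (t, u))"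
      by (simp add: Du[OF tu])
  qed
  show ?thesis
    unfolding interior_solution_def using v main by (auto simp: in\<Omega>)
qed

end

section \<open>The solution by characteristics\<close>

locale hj_inversion =
  fixes \<alpha> :: real and h h' :: "real \<Rightarrow> real"
  assumes \<alpha>_pos: "0 < \<alpha>"
    and h_deriv: "\<And>y. (h has_real_derivative h' y) (at y)"
    and h'_cont: "continuous_on UNIV h'"
    and h_zero: "h 0 = 0"
    and h'_nonneg: "\<And>y. 0 \<le> y \<Longrightarrow> 0 \<le> h' y"
    and h_unbounded: "\<And>x. \<exists>y\<ge>0. x \<le> h y"
begin

section \<open>The function \<open>h\<close> and integrals of powers of
  \<open>1 / (E + h x)\<close>\<close>

lemma h_cont: "continuous_on S h"
  using h_deriv by (auto intro!: continuous_at_imp_continuous_on DERIV_isCont)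

lemma h_mono: "0 \<le> x \<Longrightarrow> x \<le> y \<Longrightarrow> h x \<le> h y"
  using h'_nonneg h_deriv by (intro DERIV_nonneg_imp_nondecreasing[of x y h]) fastforce+

lemma h_nonneg: "0 \<le> y \<Longrightarrow> 0 \<le> h y"
  using h_mono[of 0 y] h_zero by simp

lemma h_snd_has_derivative:
  "((\<lambda>z. h (snd z)) has_derivative (\<lambda>d. h' y * snd d)) (at (E :: real, y))"
  by (rule has_derivative_compose[OF has_derivative_snd[OF has_derivative_ident]])
    (use h_deriv[of y] in \<open>simp add: has_field_derivative_def\<close>)

text \<open>Exponent 2 measures the remaining time, exponent 3 enters its derivative in
  \<open>E\<close>, and exponent 1 enters the transported value.\<close>

definition moment :: "nat \<Rightarrow> real \<Rightarrow> real \<Rightarrow> real" where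
  "moment n E y = integral {0..y} (\<lambda>x. 1 / (E + h x) ^ n)"

lemma moment_integrand_cont:
  assumes "0 < E"
  shows "continuous_on {0..y} (\<lambda>x. 1 / (E + h x) ^ n)"
proof -
  have "E + h x \<noteq> 0" if "0 \<le> x" for x using assms h_nonneg[OF that] by linarith
  then show ?thesis by (auto intro!: continuous_intros h_cont)
qed

text \<open>Differentiation under the integral sign; as \<open>h\<close> is nonnegative on the range
  of integration, the denominators stay positive for every positive \<open>E\<close>.\<close>

lemma moment_has_derivative_fst:
  assumes "0 < E"
  shows "((\<lambda>E. moment n E y) has_real_derivative - real n * moment (Suc n) E y) (at E)"
proof -
  let ?g = "\<lambda>E x. - real n * (1 / (E + h x) ^ Suc n)"
  have pos: "0 < e + h x" if "0 < e" "0 \<le> x" for e x :: real using that h_nonneg[of x] by linarith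
  have "((\<lambda>E. integral (cbox 0 y) (\<lambda>x. 1 / (E + h x) ^ n)) has_field_derivative
      integral (cbox 0 y) (?g E)) (at E within {0<..})"
  proof (rule leibniz_rule_field_derivative)
    fix e x :: real assume e: "e \<in> {0<..}" and x: "x \<in> cbox 0 y"
    have "((\<lambda>E. inverse (E + h x) ^ n) has_field_derivative
        - real n * inverse (e + h x) ^ Suc n) (at e)"
    proof (cases n)
      case (Suc m)
      have "e + h x \<noteq> 0" using pos[of e x] e x by auto
      then have "((\<lambda>E. inverse (E + h x)) has_field_derivative - (inverse (e + h x))\<^sup>2) (at e)"
        by (auto intro!: derivative_eq_intros simp: power2_eq_square)
      from DERIV_power[OF this, of n] show ?thesis
        by (simp add: Suc power2_eq_square algebra_simps)
    qed simp
    then have "((\<lambda>E. 1 / (E + h x) ^ n) has_field_derivative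
        - real n * (1 / (e + h x) ^ Suc n)) (at e)"
      by (simp only: inverse_eq_divide power_one_over)
    then show "((\<lambda>E. 1 / (E + h x) ^ n) has_field_derivative ?g e x) (at e within {0<..})"
      by (rule has_field_derivative_at_within)
  next
    fix e assume "e \<in> {0::real<..}"
    then show "(\<lambda>x. 1 / (e + h x) ^ n) integrable_on cbox 0 y"
      using integrable_continuous_interval[OF moment_integrand_cont] by simp
  next
    have "e + h x \<noteq> 0" if "0 < e" "0 \<le> x" for e x :: real using pos[OF that] by simp
    then show "continuous_on ({0<..} \<times> cbox 0 y) (\<lambda>(e, x). ?g e x)"
      unfolding split_beta
      by (intro continuous_intros continuous_on_compose2[OF h_cont[of UNIV]]) auto
  qed (use assms in auto)
  moreover have "at E within {0<..} = at E" using assms by (intro at_within_open) auto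
  ultimately show ?thesis by (simp only: moment_def integral_mult_right cbox_interval)
qed

lemma moment_has_derivative_snd:
  assumes "0 < E" "0 < y"
  shows "(moment n E has_real_derivative 1 / (E + h y) ^ n) (at y)"
proof -
  have "((\<lambda>y. integral {0..y} (\<lambda>x. 1 / (E + h x) ^ n)) has_real_derivative 1 / (E + h y) ^ n)
      (at y within {0..y + 1})"
    using assms by (intro integral_has_real_derivative moment_integrand_cont) auto
  moreover have "at y within {0..y + 1} = at y"
    using assms by (intro at_within_interior) auto
  ultimately show ?thesis by (simp add: moment_def[abs_def])
qed

text \<open>Total differentiability follows since one partial derivative exists at the point and the
  other is continuous there.\<close>

lemma moment_has_derivative:
  assumes "0 < E" "0 < y"
  shows "((\<lambda>z. moment n (fst z) (snd z)) has_derivative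
    (\<lambda>d. - real n * moment (Suc n) E y * fst d + 1 / (E + h y) ^ n * snd d)) (at (E, y))"
proof -
  let ?Q = "{0::real<..}"
  let ?fy = "\<lambda>E y. blinfun_scaleR_left (1 / (E + h y) ^ n)"
  have "((\<lambda>(E, y). moment n E y) has_derivative
      (\<lambda>(dE, dy). (- real n * moment (Suc n) E y) * dE + ?fy E y dy)) (at (E, y) within ?Q \<times> ?Q)"
  proof (rule has_derivative_partialsI)
    show "((\<lambda>x. moment n x y) has_derivative (*) (- real n * moment (Suc n) E y)) (at E within ?Q)"
      using moment_has_derivative_fst[OF assms(1), of n y]
      unfolding has_field_derivative_def by (rule has_derivative_at_withinI)
    fix e x :: real assume "e \<in> ?Q" "x \<in> ?Q"
    then have "(moment n e has_real_derivative 1 / (e + h x) ^ n) (at x)"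
      by (intro moment_has_derivative_snd) auto
    then show "(moment n e has_derivative blinfun_apply (?fy e x)) (at x within ?Q)"
      unfolding has_field_derivative_def
      by (auto simp: mult.commute intro!: has_derivative_at_withinI elim!: has_derivative_eq_rhs)
  next
    have "isCont (\<lambda>z. h (snd z)) (E, y)"
      by (rule has_derivative_continuous[OF h_snd_has_derivative])
    moreover have "(fst (E, y) + h (snd (E, y))) ^ n \<noteq> 0" using assms h_nonneg[of y] by auto
    ultimately have "isCont (\<lambda>z. ?fy (fst z) (snd z)) (E, y)"
      by (intro bounded_linear.continuous[OF bounded_linear_blinfun_scaleR_left] continuous_intros) auto
    then show "continuous (at (E, y) within ?Q \<times> ?Q) (\<lambda>(x, y). ?fy x y)"
      unfolding split_beta' by (rule continuous_at_imp_continuous_at_within)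
  qed (use assms in auto)
  moreover have "at (E, y) within ?Q \<times> ?Q = at (E, y)"
    using assms by (intro at_within_open open_Times) auto
  ultimately show ?thesis by (simp add: split_beta' mult.commute)
qed

text \<open>The integrand is nonincreasing, so on \<open>{0..\<delta>}\<close> it is at least its
  value at \<delta>, and the rest of the interval contributes a nonnegative amount.\<close>

lemma moment_ge:
  assumes "0 < E" "0 \<le> \<delta>" "\<delta> \<le> y"
  shows "\<delta> / (E + h \<delta>) ^ n \<le> moment n E y"
proof -
  have pos: "0 < E + h x" if "0 \<le> x" for x using assms h_nonneg[OF that] by linarith
  have "\<delta> / (E + h \<delta>) ^ n = integral {0..\<delta>} (\<lambda>_. 1 / (E + h \<delta>) ^ n)"
    using assms by simp
  also have "\<dots> \<le> moment n E \<delta>"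
    unfolding moment_def
    using assms pos integrable_continuous_interval[OF moment_integrand_cont[OF assms(1)]]
    by (intro integral_le divide_left_mono power_mono mult_pos_pos zero_less_power add_left_mono h_mono)
      (auto simp: less_imp_le)
  also have "\<dots> \<le> moment n E y"
    unfolding moment_def
    using assms integrable_continuous_interval[OF moment_integrand_cont[OF assms(1)]]
    by (intro integral_subset_le) (auto simp: less_imp_le pos)
  finally show ?thesis .
qed

lemma moment_le:
  assumes "0 < E" "0 \<le> y"
  shows "moment n E y \<le> y / E ^ n"
proof -
  have "moment n E y \<le> integral {0..y} (\<lambda>_. 1 / E ^ n)"
    unfolding moment_def
    using assms h_nonneg integrable_continuous_interval[OF moment_integrand_cont[OF assms(1)]]
    by (intro integral_le divide_left_mono power_mono mult_pos_pos zero_less_power)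
      (auto simp: add_pos_nonneg)
  then show ?thesis using assms by simp
qed

lemma moment_nonneg: "0 < E \<Longrightarrow> 0 \<le> y \<Longrightarrow> 0 \<le> moment n E y"
  using moment_ge[of E 0 y n] by simp

lemma moment_one_le:
  assumes "0 < E" "0 \<le> y"
  shows "moment 1 E y \<le> (E + h y) * moment 2 E y"
proof -
  have "moment 1 E y \<le> integral {0..y} (\<lambda>x. (E + h y) * (1 / (E + h x)\<^sup>2))"
    unfolding moment_def
  proof (rule integral_le)
    fix x assume x: "x \<in> {0..y}"
    then have "0 < E + h x" "E + h x \<le> E + h y" using assms h_nonneg[of x] h_mono[of x y] by auto
    then have "(E + h x) * (1 / (E + h x)\<^sup>2) \<le> (E + h y) * (1 / (E + h x)\<^sup>2)"
      by (intro mult_right_mono) auto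
    with \<open>0 < E + h x\<close> show "1 / (E + h x) ^ 1 \<le> (E + h y) * (1 / (E + h x)\<^sup>2)"
      by (simp add: power2_eq_square)
  qed (use assms in \<open>intro integrable_continuous_interval continuous_intros moment_integrand_cont; simp\<close>)+
  then show ?thesis by (simp only: moment_def integral_mult_right)
qed

text \<open>
  Along a characteristic ending at the terminal time with zero gradient, \<open>E = \<phi> - h y\<close> is
  conserved and \<open>\<alpha> * moment 2 E y\<close> is the remaining time, so inverting \<open>\<Phi>\<close> means finding the
  characteristic through a given point.
\<close>

definition \<Phi> :: "real \<times> real \<Rightarrow> real \<times> real" where
  "\<Phi> z = (fst z + h (snd z), \<alpha> * moment 2 (fst z) (snd z))"

text \<open>The determinant of the derivative of \<open>\<Phi>\<close> at
  \<open>(E, y)\<close>.\<close>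

definition jac :: "real \<Rightarrow> real \<Rightarrow> real" where
  "jac E y = \<alpha> * (1 / (E + h y)\<^sup>2 + 2 * h' y * moment 3 E y)"

lemma jac_pos:
  assumes "0 < E" "0 < y"
  shows "0 < jac E y"
  unfolding jac_def using assms \<alpha>_pos h_nonneg[of y] h'_nonneg[of y] moment_nonneg[of E y 3]
  by (intro mult_pos_pos add_pos_nonneg) auto

lemma \<Phi>_has_derivative:
  assumes "0 < E" "0 < y"
  shows "(\<Phi> has_derivative (\<lambda>d. (fst d + h' y * snd d,
    \<alpha> * (- 2 * moment 3 E y * fst d + 1 / (E + h y)\<^sup>2 * snd d)))) (at (E, y))"
  unfolding \<Phi>_def
  using moment_has_derivative[OF assms, of 2]
  by (intro has_derivative_Pair has_derivative_add has_derivative_fst has_derivative_ident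
      h_snd_has_derivative has_derivative_mult_right) (simp add: numeral_3_eq_3)

text \<open>For fixed \<phi>, raising \<open>y\<close> does not increase the energy, so the
  integrand does not decrease; strictness comes from the longer interval, as \<open>h\<close> may be
  flat. Hence \<phi> and the remaining time determine \<open>y\<close>.\<close>

lemma \<Phi>_second_strict_mono:
  assumes "0 \<le> y" "y < x" "h x < \<phi>"
  shows "moment 2 (\<phi> - h y) y < moment 2 (\<phi> - h x) x"
proof -
  have hyx: "h y \<le> h x" using assms h_mono by simp
  have pos: "0 < \<phi> - h x + h w" if "0 \<le> w" for w using assms h_nonneg[OF that] by linarith
  have "moment 2 (\<phi> - h y) y \<le> moment 2 (\<phi> - h x) y"
    unfolding moment_def
    using assms hyx pos
    by (intro integral_le integrable_continuous_interval moment_integrand_cont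
        divide_left_mono power_mono mult_pos_pos zero_less_power) (fastforce simp: less_imp_le)+
  also have "\<dots> < moment 2 (\<phi> - h x) x"
  proof (rule DERIV_pos_imp_increasing_open[OF assms(2)])
    fix w assume "y < w" "w < x"
    then show "\<exists>d. (moment 2 (\<phi> - h x) has_real_derivative d) (at w) \<and> 0 < d"
      using moment_has_derivative_snd[of "\<phi> - h x" w 2] assms pos[of w] by auto
  next
    show "continuous_on {y..x} (moment 2 (\<phi> - h x))"
    proof -
      have "continuous_on {0..x} (moment 2 (\<phi> - h x))"
        unfolding moment_def[abs_def]
        using assms
        by (intro indefinite_integral_continuous_1 integrable_continuous_interval moment_integrand_cont) auto
      then show ?thesis by (rule continuous_on_subset) (use assms in auto)
    qed
  qed
  finally show ?thesis .
qed

lemma \<Phi>_inj: "inj_on \<Phi> ({0<..} \<times> {0<..})"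
proof (rule inj_onI, clarsimp simp: \<Phi>_def)
  fix E y F x assume pos: "0 < E" "0 < y" "0 < F" "0 < x"
    and eq: "E + h y = F + h x" and "\<alpha> = 0 \<or> moment 2 E y = moment 2 F x"
  then have m: "moment 2 E y = moment 2 F x" using \<alpha>_pos by simp
  have E: "E = (E + h y) - h y" and F: "F = (E + h y) - h x" using eq by auto
  have "\<not> y < x" using \<Phi>_second_strict_mono[of y x "E + h y"] pos m eq E F by fastforce
  moreover have "\<not> x < y" using \<Phi>_second_strict_mono[of x y "E + h y"] pos m eq E F by fastforce
  ultimately have "x = y" by simp
  then show "E = F \<and> y = x" using eq by simp
qed

text \<open>For fixed \<phi>, the remaining time is a continuous function of \<open>y\<close> that
  is small near 0 and exceeds any given \<tau> as the energy approaches 0; the intermediate value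
  theorem applies.\<close>

lemma \<Phi>_surj:
  assumes "0 < \<phi>" "0 < \<tau>"
  shows "\<exists>E>0. \<exists>y>0. \<Phi> (E, y) = (\<phi>, \<tau>)"
proof -
  obtain y\<^sub>1 where y1: "0 \<le> y\<^sub>1" "\<phi> \<le> h y\<^sub>1" using h_unbounded by blast
  have "\<exists>Y\<ge>0. Y \<le> y\<^sub>1 \<and> h Y = \<phi>"
    using y1 h_zero assms h_cont by (intro IVT') auto
  then obtain Y\<^sub>1 where Y1: "0 \<le> Y\<^sub>1" "h Y\<^sub>1 = \<phi>" by blast
  \<comment> \<open>Taking the least point where \<open>h\<close> reaches \<phi> keeps the energy
    positive at all smaller \<open>y\<close>, even if \<open>h\<close> is flat at that
    level.\<close>
  have cl: "compact {y \<in> {0..Y\<^sub>1}. \<phi> \<le> h y}"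
    unfolding compact_eq_bounded_closed
    by (intro conjI continuous_on_closed_Collect_le h_cont continuous_on_const
        bounded_subset[OF bounded_closed_interval[of 0 Y\<^sub>1]]) auto
  moreover have "{y \<in> {0..Y\<^sub>1}. \<phi> \<le> h y} \<noteq> {}" using Y1 by auto
  ultimately obtain Y where Y: "0 \<le> Y" "Y \<le> Y\<^sub>1" "\<phi> \<le> h Y"
    and least: "\<And>y. 0 \<le> y \<Longrightarrow> y \<le> Y\<^sub>1 \<Longrightarrow> \<phi> \<le> h y \<Longrightarrow> Y \<le> y"
    using compact_attains_inf[of "{y \<in> {0..Y\<^sub>1}. \<phi> \<le> h y}"] by auto
  have hY: "h Y = \<phi>" using Y Y1 h_mono[of Y Y\<^sub>1] by simp
  have Y0: "0 < Y" using Y hY h_zero assms by (cases "Y = 0") auto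
  have below: "h y < \<phi>" if "0 \<le> y" "y < Y" for y
    using least[of y] that Y by (meson linorder_not_less order_trans less_imp_le)
  define g where "g = (\<lambda>y. \<alpha> * moment 2 (\<phi> - h y) y)"
  have g_cont: "continuous_on {0<..<Y} g"
  proof (rule continuous_at_imp_continuous_on, safe)
    fix y assume y: "y \<in> {0<..<Y}"
    then have "((\<lambda>z. moment 2 (fst z) (snd z)) has_derivative
        (\<lambda>d. - real 2 * moment (Suc 2) (\<phi> - h y) y * fst d + 1 / (\<phi> - h y + h y)\<^sup>2 * snd d))
        (at (\<phi> - h y, y))"
      using below[of y] by (intro moment_has_derivative) auto
    from has_derivative_continuous[OF this]
    have "isCont (\<lambda>z. moment 2 (fst z) (snd z)) (\<phi> - h y, y)" .
    moreover have "isCont (\<lambda>y. (\<phi> - h y, y)) y"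
      using h_deriv DERIV_isCont by (intro continuous_intros) blast
    ultimately have "isCont (\<lambda>y. moment 2 (\<phi> - h y) y) y"
      using isCont_o2[of y "\<lambda>y. (\<phi> - h y, y)" "\<lambda>z. moment 2 (fst z) (snd z)"] by simp
    then show "isCont g y" unfolding g_def by (intro continuous_intros)
  qed
  have "compact (h' ` {0..Y})"
    by (intro compact_continuous_image continuous_on_subset[OF h'_cont]) auto
  then obtain M where M: "0 < M" "\<And>y. 0 \<le> y \<Longrightarrow> y \<le> Y \<Longrightarrow> \<bar>h' y\<bar> \<le> M"
    using compact_imp_bounded bounded_pos by (metis atLeastAtMost_iff imageI real_norm_def)
  have hM: "h y - h x \<le> M * (y - x)" if xy: "0 \<le> x" "x < y" "y \<le> Y" for x y
  proof -
    obtain w where "x < w" "w < y" "h y - h x = (y - x) * h' w"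
      using MVT2[OF xy(2), of h h'] h_deriv by blast
    moreover have "(y - x) * h' w \<le> (y - x) * M"
      using M(2)[of w] xy \<open>x < w\<close> \<open>w < y\<close> by (intro mult_left_mono) auto
    ultimately show ?thesis by (simp add: mult.commute)
  qed
  \<comment> \<open>Both the energy at \<open>y\<^sub>2\<close> and \<open>h \<delta>\<close> are at
    most \<open>M * \<delta>\<close>, so the part of the integral over \<open>{0..\<delta>}\<close>
    alone gives a time of at least \<open>\<alpha> / (4 * M\<^sup>2 * \<delta>)\<close>, which is at
    least \<tau>.\<close>
  define \<delta> where "\<delta> = min (Y / 2) (\<alpha> / (4 * M\<^sup>2 * \<tau>))"
  have \<delta>: "0 < \<delta>" "\<delta> < Y" "\<delta> \<le> \<alpha> / (4 * M\<^sup>2 * \<tau>)"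
    using Y0 \<alpha>_pos M assms by (auto simp: \<delta>_def)
  define y\<^sub>2 where "y\<^sub>2 = max \<delta> (Y - \<delta>)"
  have y2: "\<delta> \<le> y\<^sub>2" "y\<^sub>2 < Y" "Y - y\<^sub>2 \<le> \<delta>" using \<delta> by (auto simp: y\<^sub>2_def)
  define E where "E = \<phi> - h y\<^sub>2"
  have E: "0 < E" using below[of y\<^sub>2] y2 \<delta> by (simp add: E_def)
  have "E \<le> M * (Y - y\<^sub>2)" using hM[of y\<^sub>2 Y] y2 \<delta> by (simp add: E_def hY)
  also have "\<dots> \<le> M * \<delta>" using y2 M by (intro mult_left_mono) auto
  finally have "E \<le> M * \<delta>" .
  moreover have "h \<delta> \<le> M * \<delta>" using hM[of 0 \<delta>] \<delta> by (simp add: h_zero)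
  ultimately have "E + h \<delta> \<le> 2 * M * \<delta>" by simp
  moreover have "0 < E + h \<delta>" using E h_nonneg[of \<delta>] \<delta> by simp
  ultimately have "(E + h \<delta>)\<^sup>2 \<le> (2 * M * \<delta>)\<^sup>2" "0 < (E + h \<delta>)\<^sup>2"
    by (auto intro!: power_mono)
  have "\<tau> \<le> \<alpha> * (\<delta> / (2 * M * \<delta>)\<^sup>2)"
    using \<delta> M assms by (simp add: field_simps power2_eq_square)
  also have "\<dots> \<le> \<alpha> * (\<delta> / (E + h \<delta>)\<^sup>2)"
    using \<delta> M \<alpha>_pos \<open>(E + h \<delta>)\<^sup>2 \<le> (2 * M * \<delta>)\<^sup>2\<close> \<open>0 < (E + h \<delta>)\<^sup>2\<close>
    by (intro mult_left_mono divide_left_mono mult_pos_pos) auto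
  also have "\<dots> \<le> g y\<^sub>2"
    unfolding g_def E_def[symmetric] using \<alpha>_pos E \<delta> y2 by (intro mult_left_mono moment_ge) auto
  finally have hi: "\<tau> \<le> g y\<^sub>2" .
  \<comment> \<open>Up to \<open>Y / 2\<close> the energy is at least \<open>e\<close>, so the time
    at \<open>y\<close> is at most \<open>\<alpha> * y / e\<^sup>2\<close>; \<open>y\<^sub>3\<close>
    is chosen to bring this below \<tau>.\<close>
  define e where "e = \<phi> - h (Y / 2)"
  have e: "0 < e" using below[of "Y / 2"] Y0 by (simp add: e_def)
  define y\<^sub>3 where "y\<^sub>3 = min (min (Y / 2) y\<^sub>2) (\<tau> * e\<^sup>2 / \<alpha>)"
  have y3: "0 < y\<^sub>3" "y\<^sub>3 \<le> Y / 2" "y\<^sub>3 \<le> y\<^sub>2" "y\<^sub>3 \<le> \<tau> * e\<^sup>2 / \<alpha>"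
  proof -
    show "0 < y\<^sub>3" using Y0 y2 \<delta> e \<alpha>_pos assms by (auto simp: y\<^sub>3_def)
  qed (simp_all only: y\<^sub>3_def min_le_iff_disj order_refl simp_thms)
  have e3: "e \<le> \<phi> - h y\<^sub>3" using y3 h_mono[of y\<^sub>3 "Y / 2"] by (simp add: e_def)
  have "g y\<^sub>3 \<le> \<alpha> * (y\<^sub>3 / (\<phi> - h y\<^sub>3)\<^sup>2)"
    unfolding g_def using \<alpha>_pos e e3 y3 by (intro mult_left_mono moment_le) auto
  also have "\<dots> \<le> \<alpha> * (y\<^sub>3 / e\<^sup>2)"
    using \<alpha>_pos e e3 y3 by (intro mult_left_mono divide_left_mono power_mono mult_pos_pos zero_less_power) auto
  also have "\<dots> \<le> \<tau>" using y3 \<alpha>_pos e by (simp add: field_simps)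
  finally have lo: "g y\<^sub>3 \<le> \<tau>" .
  have "\<exists>y\<ge>y\<^sub>3. y \<le> y\<^sub>2 \<and> g y = \<tau>"
    using y3 y2 lo hi by (intro IVT' continuous_on_subset[OF g_cont]) auto
  then obtain y where y: "y\<^sub>3 \<le> y" "y \<le> y\<^sub>2" "g y = \<tau>" by blast
  then have "0 < y" "h y < \<phi>" using y3 y2 below[of y] by auto
  then show ?thesis
    using y(3) by (intro exI[of _ "\<phi> - h y"] exI[of _ y]) (auto simp: \<Phi>_def g_def)
qed

definition \<Psi> :: "real \<times> real \<Rightarrow> real \<times> real" where
  "\<Psi> = inv_into ({0<..} \<times> {0<..}) \<Phi>"

lemma \<Psi>:
  assumes "0 < \<phi>" "0 < \<tau>"
  shows "0 < fst (\<Psi> (\<phi>, \<tau>))" "0 < snd (\<Psi> (\<phi>, \<tau>))" "\<Phi> (\<Psi> (\<phi>, \<tau>)) = (\<phi>, \<tau>)"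
proof -
  have "(\<phi>, \<tau>) \<in> \<Phi> ` ({0<..} \<times> {0<..})" using \<Phi>_surj[OF assms] by force
  from inv_into_into[OF this] f_inv_into_f[OF this]
  show "0 < fst (\<Psi> (\<phi>, \<tau>))" "0 < snd (\<Psi> (\<phi>, \<tau>))" "\<Phi> (\<Psi> (\<phi>, \<tau>)) = (\<phi>, \<tau>)"
    by (auto simp: \<Psi>_def)
qed

text \<open>Inverse function theorem; the stated derivative is the adjugate of the derivative matrix
  of \<open>\<Phi>\<close> divided by its determinant.\<close>

lemma \<Psi>_has_derivative:
  assumes pos: "0 < \<phi>" "0 < \<tau>" and Ey: "\<Psi> (\<phi>, \<tau>) = (E, y)"
  shows "(\<Psi> has_derivative (\<lambda>d.
    ((\<alpha> / \<phi>\<^sup>2 * fst d - h' y * snd d) / jac E y,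
     (2 * \<alpha> * moment 3 E y * fst d + snd d) / jac E y))) (at (\<phi>, \<tau>))"
proof (rule has_derivative_inverse_strong_x[where S = "{0<..} \<times> {0<..}" and f = \<Phi>])
  have Epos: "0 < E" "0 < y" and \<phi>: "E + h y = \<phi>"
    using \<Psi>[OF pos] Ey by (auto simp: \<Phi>_def)
  show "open ({0::real<..} \<times> {0::real<..})" by (intro open_Times) auto
  show "\<Psi> (\<phi>, \<tau>) \<in> {0<..} \<times> {0<..}" using Epos Ey by simp
  show "continuous_on ({0<..} \<times> {0<..}) \<Phi>"
    by (rule continuous_at_imp_continuous_on, clarify, rule has_derivative_continuous[OF \<Phi>_has_derivative]) auto
  show "\<Psi> (\<Phi> x) = x" if "x \<in> {0<..} \<times> {0<..}" for x
    unfolding \<Psi>_def by (rule inv_into_f_f[OF \<Phi>_inj that])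
  show "(\<Phi> has_derivative (\<lambda>d. (fst d + h' y * snd d,
      \<alpha> * (- 2 * moment 3 E y * fst d + 1 / \<phi>\<^sup>2 * snd d)))) (at (\<Psi> (\<phi>, \<tau>)))"
    using \<Phi>_has_derivative[OF Epos] by (simp add: Ey \<phi>)
  show "\<Phi> (\<Psi> (\<phi>, \<tau>)) = (\<phi>, \<tau>)" using \<Psi>[OF pos] by simp
  define J where "J = jac E y"
  have J: "J \<noteq> 0" and Jd: "J = \<alpha> / \<phi>\<^sup>2 + 2 * \<alpha> * h' y * moment 3 E y"
    using jac_pos[OF Epos] by (auto simp: J_def jac_def \<phi> algebra_simps)
  show "(\<lambda>d. (fst d + h' y * snd d, \<alpha> * (- 2 * moment 3 E y * fst d + 1 / \<phi>\<^sup>2 * snd d))) \<circ>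
      (\<lambda>d. ((\<alpha> / \<phi>\<^sup>2 * fst d - h' y * snd d) / jac E y,
        (2 * \<alpha> * moment 3 E y * fst d + snd d) / jac E y)) = id"
  proof
    fix d :: "real \<times> real"
    have "(\<alpha> / \<phi>\<^sup>2 * fst d - h' y * snd d) / J + h' y * ((2 * \<alpha> * moment 3 E y * fst d + snd d) / J)
        = J * fst d / J"
      unfolding Jd by (simp add: add_divide_distrib diff_divide_distrib algebra_simps)
    then have 1: "(\<alpha> / \<phi>\<^sup>2 * fst d - h' y * snd d) / J
        + h' y * ((2 * \<alpha> * moment 3 E y * fst d + snd d) / J) = fst d" using J by simp
    have "\<alpha> * (- 2 * moment 3 E y * ((\<alpha> / \<phi>\<^sup>2 * fst d - h' y * snd d) / J)
        + 1 / \<phi>\<^sup>2 * ((2 * \<alpha> * moment 3 E y * fst d + snd d) / J)) = J * snd d / J"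
      unfolding Jd by (simp add: add_divide_distrib diff_divide_distrib algebra_simps)
    then have 2: "\<alpha> * (- 2 * moment 3 E y * ((\<alpha> / \<phi>\<^sup>2 * fst d - h' y * snd d) / J)
        + 1 / \<phi>\<^sup>2 * ((2 * \<alpha> * moment 3 E y * fst d + snd d) / J)) = snd d" using J by simp
    show "((\<lambda>d. (fst d + h' y * snd d, \<alpha> * (- 2 * moment 3 E y * fst d + 1 / \<phi>\<^sup>2 * snd d))) \<circ>
      (\<lambda>d. ((\<alpha> / \<phi>\<^sup>2 * fst d - h' y * snd d) / jac E y,
        (2 * \<alpha> * moment 3 E y * fst d + snd d) / jac E y))) d = id d"
      by (simp only: o_apply fst_conv snd_conv id_apply J_def[symmetric] 1 2 prod.collapse)
  qed
qed

lemma moment_continuous_on: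
  "continuous_on ({0<..} \<times> {0<..}) (\<lambda>z. moment n (fst z) (snd z))"
  by (rule continuous_at_imp_continuous_on, clarify, rule has_derivative_continuous[OF moment_has_derivative]) auto

text \<open>
  The value transported along the characteristic, \<open>E * \<tau> + \<alpha> * (\<integral>x * h' x / (E + h x)\<^sup>2)\<close>, after
  integration by parts. In the coordinates \<open>(\<phi>, \<tau>) = \<Phi> (E, y)\<close> its differential is
  \<open>E d\<tau> + \<alpha> y / \<phi>\<^sup>2 d\<phi>\<close>.
\<close>

definition W :: "real \<times> real \<Rightarrow> real" where
  "W z = \<alpha> * (fst z * moment 2 (fst z) (snd z) + moment 1 (fst z) (snd z) - snd z / (fst z + h (snd z)))"

text \<open>The \<open>moment 2\<close> terms from the product and from \<open>moment 1\<close>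
  cancel, as do the two terms in dy / (E + h y). The remainder groups into the two components of the
  differential of \<open>\<Phi>\<close>.\<close>

lemma W_has_derivative:
  assumes "0 < E" "0 < y"
  shows "(W has_derivative (\<lambda>d. E * (\<alpha> * (- 2 * moment 3 E y * fst d + 1 / (E + h y)\<^sup>2 * snd d))
    + \<alpha> * y / (E + h y)\<^sup>2 * (fst d + h' y * snd d))) (at (E, y))"
proof -
  have pos: "0 < E + h y" using assms h_nonneg[of y] by simp
  note m1 = moment_has_derivative[OF assms, of 1] and m2 = moment_has_derivative[OF assms, of 2]
  have "(W has_derivative (\<lambda>d. \<alpha> * (
      (fst (E, y) * (- real 2 * moment (Suc 2) E y * fst d + 1 / (E + h y) ^ 2 * snd d)
        + fst d * moment 2 (fst (E, y)) (snd (E, y)))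
      + (- real 1 * moment (Suc 1) E y * fst d + 1 / (E + h y) ^ 1 * snd d)
      - (snd d * (fst (E, y) + h (snd (E, y))) - snd (E, y) * (fst d + h' y * snd d)) /
        ((fst (E, y) + h (snd (E, y))) * (fst (E, y) + h (snd (E, y))))))) (at (E, y))"
    unfolding W_def
    by (intro has_derivative_mult_right has_derivative_diff has_derivative_add
        has_derivative_mult has_derivative_divide' m1 m2 h_snd_has_derivative
        has_derivative_fst has_derivative_snd has_derivative_ident) (use pos in auto)
  moreover have "\<alpha> * (
      (fst (E, y) * (- real 2 * moment (Suc 2) E y * fst d + 1 / (E + h y) ^ 2 * snd d)
        + fst d * moment 2 (fst (E, y)) (snd (E, y)))
      + (- real 1 * moment (Suc 1) E y * fst d + 1 / (E + h y) ^ 1 * snd d)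
      - (snd d * (fst (E, y) + h (snd (E, y))) - snd (E, y) * (fst d + h' y * snd d)) /
        ((fst (E, y) + h (snd (E, y))) * (fst (E, y) + h (snd (E, y))))) =
    E * (\<alpha> * (- 2 * moment 3 E y * fst d + 1 / (E + h y)\<^sup>2 * snd d))
    + \<alpha> * y / (E + h y)\<^sup>2 * (fst d + h' y * snd d)" for d
  proof -
    define s where "s = E + h y"
    have s: "s \<noteq> 0" using pos by (simp add: s_def)
    have suc: "Suc 1 = 2" "Suc 2 = 3" by simp_all
    have "(snd d * s - y * (fst d + h' y * snd d)) / (s * s)
        = snd d / s - y / s\<^sup>2 * (fst d + h' y * snd d)"
      using s by (simp add: field_simps power2_eq_square)
    then show ?thesis
      by (simp only: fst_conv snd_conv s_def[symmetric] suc)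
        (simp add: algebra_simps add_divide_distrib diff_divide_distrib)
  qed
  ultimately show ?thesis by (simp only:)
qed

text \<open>Each of the three terms of \<open>W\<close> is at most \<phi> \<tau>. As \<phi> is
  bounded for u \<ge> 0, this gives the terminal value uniformly in u.\<close>

lemma W_bound:
  assumes "0 < E" "0 < y"
  shows "\<bar>W (E, y)\<bar> \<le> 3 * (E + h y) * (\<alpha> * moment 2 E y)"
proof -
  define m where "m = moment 2 E y"
  have pos: "0 < E + h y" "0 \<le> h y" using assms h_nonneg[of y] by simp_all
  have m: "0 \<le> m" using assms moment_nonneg[of E y 2] by (simp add: m_def)
  have "y / (E + h y)\<^sup>2 \<le> m" using moment_ge[of E y y 2] assms by (simp add: m_def)
  then have "y / (E + h y)\<^sup>2 * (E + h y) \<le> m * (E + h y)" using pos by (intro mult_right_mono) auto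
  then have 1: "y / (E + h y) \<le> (E + h y) * m" using pos by (simp add: power2_eq_square mult.commute)
  have 2: "moment 1 E y \<le> (E + h y) * m" using moment_one_le[of E y] assms by (simp add: m_def)
  have 3: "E * m \<le> (E + h y) * m" using pos m by (intro mult_right_mono) auto
  have "0 \<le> moment 1 E y" "0 \<le> y / (E + h y)" "0 \<le> E * m"
    using assms pos m moment_nonneg[of E y 1] by auto
  then have "\<bar>E * m + moment 1 E y - y / (E + h y)\<bar> \<le> 3 * ((E + h y) * m)"
    using 1 2 3 by linarith
  then have "\<alpha> * \<bar>E * m + moment 1 E y - y / (E + h y)\<bar> \<le> \<alpha> * (3 * ((E + h y) * m))"
    using \<alpha>_pos by (intro mult_left_mono) auto
  moreover have "\<bar>W (E, y)\<bar> = \<alpha> * \<bar>E * m + moment 1 E y - y / (E + h y)\<bar>"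
    unfolding W_def m_def fst_conv snd_conv abs_mult using \<alpha>_pos by simp
  ultimately have "\<bar>W (E, y)\<bar> \<le> \<alpha> * (3 * ((E + h y) * m))" by (simp only:)
  also have "\<dots> = 3 * (E + h y) * (\<alpha> * moment 2 E y)" by (simp add: m_def algebra_simps)
  finally show ?thesis .
qed

end

section \<open>The solution in the variables t and u\<close>

locale hj_construction = hj_inversion +
  fixes T B c :: real
  assumes T_pos: "0 < T" and B_pos: "0 < B"
begin

definition f :: "real \<Rightarrow> real" where "f u = \<alpha> * B / (B * u + 1)"

lemma f_pos: "0 < B * u + 1 \<Longrightarrow> 0 < f u"
  using \<alpha>_pos B_pos by (simp add: f_def)

lemma f_deriv:
  assumes "0 < B * u + 1"
  shows "(f has_real_derivative - (f u)\<^sup>2 / \<alpha>) (at u)"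
proof -
  have "((\<lambda>u. B * u + 1) has_real_derivative B) (at u)"
    by (auto intro!: derivative_eq_intros)
  then have "(f has_real_derivative (0 * (B * u + 1) - \<alpha> * B * B) / ((B * u + 1) * (B * u + 1))) (at u)"
    unfolding f_def[abs_def] using assms by (intro DERIV_divide DERIV_const) auto
  moreover have "(0 * (B * u + 1) - \<alpha> * B * B) / ((B * u + 1) * (B * u + 1)) = - (f u)\<^sup>2 / \<alpha>"
    using \<alpha>_pos by (simp add: f_def power2_eq_square)
  ultimately show ?thesis by (simp only:)
qed

text \<open>The energy and the negative gradient of the characteristic through the point (t,
  u).\<close>

definition X :: "real \<times> real \<Rightarrow> real \<times> real" where
  "X z = \<Psi> (f (snd z), T - fst z)"

text \<open>An open set containing the strip, with negative t and slightly negative u allowed, so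
  that derivatives at the edges t = 0 and u = 0 are obtained by restriction.\<close>

definition dom :: "(real \<times> real) set" where
  "dom = {..<T} \<times> {u. 0 < B * u + 1}"

lemma open_dom: "open dom"
  unfolding dom_def by (intro open_Times open_Collect_less continuous_intros open_lessThan)

lemma X:
  assumes "z \<in> dom"
  shows "0 < fst (X z)" "0 < snd (X z)" "fst (X z) + h (snd (X z)) = f (snd z)"
    "\<alpha> * moment 2 (fst (X z)) (snd (X z)) = T - fst z"
  using \<Psi>[of "f (snd z)" "T - fst z"] f_pos[of "snd z"] assms
  by (auto simp: X_def dom_def \<Phi>_def)

definition J :: "real \<times> real \<Rightarrow> real" where "J z = jac (fst (X z)) (snd (X z))"

definition m3 :: "real \<times> real \<Rightarrow> real" where "m3 z = moment 3 (fst (X z)) (snd (X z))"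

text \<open>The speed of the characteristic, not a derivative of its gradient.\<close>

definition y' :: "real \<times> real \<Rightarrow> real" where "y' z = h' (snd (X z))"

lemma J_pos: "z \<in> dom \<Longrightarrow> 0 < J z"
  unfolding J_def by (intro jac_pos X)

text \<open>Chain rule with d\<phi> = - (\<phi>^2 / \<alpha>) du and d\<tau> = - dt. The matrix is
  symmetric, being the negative Hessian of the solution.\<close>

lemma X_has_derivative:
  assumes z: "z \<in> dom"
  shows "(X has_derivative (\<lambda>d.
    (y' z / J z * fst d + (- 1 / J z) * snd d,
     (- 1 / J z) * fst d + (- 2 * m3 z * (f (snd z))\<^sup>2 / J z) * snd d))) (at z)"
proof -
  define \<phi> where "\<phi> = f (snd z)"
  have \<phi>: "0 < \<phi>" using f_pos z by (auto simp: \<phi>_def dom_def)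
  have T: "0 < T - fst z" using z by (auto simp: dom_def)
  have "0 < B * snd z + 1" using z by (auto simp: dom_def)
  from f_deriv[OF this] have "(f has_derivative (\<lambda>x. - \<phi>\<^sup>2 / \<alpha> * x)) (at (snd z))"
    unfolding has_field_derivative_def \<phi>_def .
  then have "((\<lambda>z. f (snd z)) has_derivative (\<lambda>d. - \<phi>\<^sup>2 / \<alpha> * snd d)) (at z)"
    by (rule has_derivative_compose[OF has_derivative_snd[OF has_derivative_ident]])
  moreover have "((\<lambda>z. T - fst z) has_derivative (\<lambda>d. 0 - fst d)) (at z)"
    by (intro has_derivative_diff has_derivative_const has_derivative_fst has_derivative_ident)
  ultimately have g: "((\<lambda>z. (f (snd z), T - fst z)) has_derivative
      (\<lambda>d. (- \<phi>\<^sup>2 / \<alpha> * snd d, 0 - fst d))) (at z)"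
    by (rule has_derivative_Pair)
  have "\<Psi> (\<phi>, T - fst z) = (fst (X z), snd (X z))" by (simp add: X_def \<phi>_def)
  from has_derivative_compose[OF g \<Psi>_has_derivative[OF \<phi> T this, unfolded \<phi>_def]]
  have "(X has_derivative (\<lambda>d.
      ((\<alpha> / \<phi>\<^sup>2 * (- \<phi>\<^sup>2 / \<alpha> * snd d) - y' z * (0 - fst d)) / J z,
       (2 * \<alpha> * m3 z * (- \<phi>\<^sup>2 / \<alpha> * snd d) + (0 - fst d)) / J z))) (at z)"
    by (simp add: X_def[abs_def] J_def m3_def y'_def \<phi>_def)
  moreover have "(\<lambda>d. ((\<alpha> / \<phi>\<^sup>2 * (- \<phi>\<^sup>2 / \<alpha> * snd d) - y' z * (0 - fst d)) / J z,
       (2 * \<alpha> * m3 z * (- \<phi>\<^sup>2 / \<alpha> * snd d) + (0 - fst d)) / J z)) =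
     (\<lambda>d::real \<times> real. (y' z / J z * fst d + (- 1 / J z) * snd d,
       (- 1 / J z) * fst d + (- 2 * m3 z * \<phi>\<^sup>2 / J z) * snd d))"
    using \<phi> \<alpha>_pos J_pos[OF z] by (auto simp: fun_eq_iff field_simps)
  ultimately show ?thesis by (simp only: \<phi>_def)
qed

lemma X_continuous_on: "continuous_on dom X"
  by (intro continuous_at_imp_continuous_on ballI has_derivative_continuous[OF X_has_derivative])

lemma m3_continuous_on: "continuous_on dom m3"
  unfolding m3_def[abs_def]
  by (rule continuous_on_compose2[OF moment_continuous_on X_continuous_on])
    (simp add: image_subset_iff mem_Times_iff X)

lemma y'_continuous_on: "continuous_on dom y'"
  unfolding y'_def[abs_def]
  by (intro continuous_on_compose2[OF h'_cont] continuous_intros X_continuous_on) auto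

lemma f_snd_continuous_on: "continuous_on dom (\<lambda>z. f (snd z))"
  unfolding f_def by (intro continuous_intros) (auto simp: dom_def)

lemma J_continuous_on: "continuous_on dom J"
proof -
  have "continuous_on dom (\<lambda>z. \<alpha> * (1 / (f (snd z))\<^sup>2 + 2 * y' z * m3 z))"
    using f_pos
    by (intro continuous_intros f_snd_continuous_on y'_continuous_on m3_continuous_on)
      (fastforce simp: dom_def)
  then show ?thesis
    by (rule continuous_on_eq) (simp add: J_def jac_def m3_def y'_def X)
qed

definition \<Gamma> :: "real \<times> real \<Rightarrow> real" where
  "\<Gamma> z = (if fst z < T then c + W (X z) else c)"

lemma \<Gamma>_has_derivative:
  assumes z: "z \<in> dom"
  shows "(\<Gamma> has_derivative (\<lambda>d. - fst (X z) * fst d + - snd (X z) * snd d)) (at z)"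
proof -
  define E where "E = fst (X z)"
  define y where "y = snd (X z)"
  define \<phi> where "\<phi> = f (snd z)"
  have \<phi>: "E + h y = \<phi>" "0 < E" "0 < y" "0 < \<phi>"
    using X[OF z] f_pos z by (auto simp: E_def y_def \<phi>_def dom_def)
  have X_eq: "X z = (E, y)" by (simp add: E_def y_def)
  have J: "J z = \<alpha> * (1 / \<phi>\<^sup>2 + 2 * y' z * m3 z)" "J z \<noteq> 0"
    using J_pos[OF z] \<phi> by (auto simp: J_def jac_def m3_def y'_def X_eq)
  define D\<^sub>1 where "D\<^sub>1 = (\<lambda>d::real \<times> real. y' z / J z * fst d + (- 1 / J z) * snd d)"
  define D\<^sub>2 where "D\<^sub>2 = (\<lambda>d::real \<times> real. (- 1 / J z) * fst d + (- 2 * m3 z * \<phi>\<^sup>2 / J z) * snd d)"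
  have "(X has_derivative (\<lambda>d. (D\<^sub>1 d, D\<^sub>2 d))) (at z)"
    using X_has_derivative[OF z] by (simp only: D\<^sub>1_def D\<^sub>2_def \<phi>_def)
  from has_derivative_compose[OF this, of W, unfolded X_eq, OF W_has_derivative[OF \<phi>(2,3)]]
  have W': "((\<lambda>z. W (X z)) has_derivative (\<lambda>d. E * (\<alpha> * (- 2 * m3 z * D\<^sub>1 d + 1 / \<phi>\<^sup>2 * D\<^sub>2 d))
    + \<alpha> * y / \<phi>\<^sup>2 * (D\<^sub>1 d + y' z * D\<^sub>2 d))) (at z)"
    by (simp add: \<phi>(1) m3_def y'_def X_eq)
  \<comment> \<open>This identity and the next recover d\<tau> = - dt and d\<phi> = - (\<phi>^2 /
    \<alpha>) du; inserted into E d\<tau> + (\<alpha> y / \<phi>^2) d\<phi> they give - E dt - y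
    du.\<close>
  have 1: "\<alpha> * (- 2 * m3 z * D\<^sub>1 d + 1 / \<phi>\<^sup>2 * D\<^sub>2 d) = - fst d" for d
  proof -
    have "\<alpha> * (- 2 * m3 z * D\<^sub>1 d + 1 / \<phi>\<^sup>2 * D\<^sub>2 d)
        = - fst d * (\<alpha> * (1 / \<phi>\<^sup>2 + 2 * y' z * m3 z)) / J z"
      unfolding D\<^sub>1_def D\<^sub>2_def using J(2) \<phi>(4) by (simp add: field_simps)
    then show ?thesis using J by simp
  qed
  have 2: "D\<^sub>1 d + y' z * D\<^sub>2 d = - \<phi>\<^sup>2 / \<alpha> * snd d" for d
  proof -
    have "D\<^sub>1 d + y' z * D\<^sub>2 d = - \<phi>\<^sup>2 / \<alpha> * snd d * (\<alpha> * (1 / \<phi>\<^sup>2 + 2 * y' z * m3 z)) / J z"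
      unfolding D\<^sub>1_def D\<^sub>2_def using J(2) \<phi>(4) \<alpha>_pos by (simp add: field_simps)
    then show ?thesis using J by simp
  qed
  have "((\<lambda>z. W (X z)) has_derivative (\<lambda>d. - E * fst d + - y * snd d)) (at z)"
    using W' unfolding 1 2 using \<phi>(4) \<alpha>_pos by simp
  from has_derivative_add[OF has_derivative_const this, of c]
  have "((\<lambda>z. c + W (X z)) has_derivative (\<lambda>d. - E * fst d + - y * snd d)) (at z)" by simp
  then show ?thesis
    unfolding E_def y_def
    by (rule has_derivative_transform_within_open[OF _ open_dom z]) (auto simp: \<Gamma>_def dom_def)
qed

lemma strip_subset_dom: "{0..<T} \<times> {0..} \<subseteq> dom"
  using B_pos by (auto simp: dom_def add_nonneg_pos)

lemma \<Gamma>_C2: "C2_on ({0..<T} \<times> {0..}) \<Gamma>"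
proof (rule C2_on_pairI[where a = "\<lambda>z. - fst (X z)" and b = "\<lambda>z. - snd (X z)"
      and ?a1.0 = "\<lambda>z. - (y' z / J z)" and ?a2.0 = "\<lambda>z. 1 / J z"
      and ?b1.0 = "\<lambda>z. 1 / J z" and ?b2.0 = "\<lambda>z. 2 * m3 z * (f (snd z))\<^sup>2 / J z"])
  fix z assume "z \<in> {0..<T} \<times> {0::real..}"
  then have z: "z \<in> dom" using strip_subset_dom by blast
  note wi = has_derivative_at_withinI
  show "(\<Gamma> has_derivative (\<lambda>d. - fst (X z) * fst d + - snd (X z) * snd d)) (at z within {0..<T} \<times> {0..})"
    by (rule wi[OF \<Gamma>_has_derivative[OF z]])
  show "((\<lambda>z. - fst (X z)) has_derivative (\<lambda>d. - (y' z / J z) * fst d + 1 / J z * snd d))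
      (at z within {0..<T} \<times> {0..})"
    using wi[OF has_derivative_minus[OF has_derivative_fst[OF X_has_derivative[OF z]]]] by (simp add: add.commute)
  show "((\<lambda>z. - snd (X z)) has_derivative
      (\<lambda>d. 1 / J z * fst d + 2 * m3 z * (f (snd z))\<^sup>2 / J z * snd d)) (at z within {0..<T} \<times> {0..})"
    using wi[OF has_derivative_minus[OF has_derivative_snd[OF X_has_derivative[OF z]]]] by (simp add: add.commute)
next
  have J: "\<forall>z\<in>dom. J z \<noteq> 0" using J_pos by force
  note ci = continuous_intros J_continuous_on m3_continuous_on y'_continuous_on f_snd_continuous_on J
  show "continuous_on ({0..<T} \<times> {0..}) (\<lambda>z. - (y' z / J z))"
    by (rule continuous_on_subset[OF _ strip_subset_dom]) (intro ci)
  show "continuous_on ({0..<T} \<times> {0..}) (\<lambda>z. 1 / J z)"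
    by (rule continuous_on_subset[OF _ strip_subset_dom]) (intro ci)
  then show "continuous_on ({0..<T} \<times> {0..}) (\<lambda>z. 1 / J z)" .
  show "continuous_on ({0..<T} \<times> {0..}) (\<lambda>z. 2 * m3 z * (f (snd z))\<^sup>2 / J z)"
    by (rule continuous_on_subset[OF _ strip_subset_dom]) (intro ci)
qed

lemma \<Gamma>_continuous_on: "continuous_on ({0..T} \<times> {0..}) \<Gamma>"
  unfolding continuous_on_eq_continuous_within
proof
  fix z assume z: "z \<in> {0..T} \<times> {0::real..}"
  show "continuous (at z within {0..T} \<times> {0..}) \<Gamma>"
  proof (cases "fst z < T")
    case True
    then have "z \<in> dom" using z strip_subset_dom by (cases z) auto
    then have "isCont \<Gamma> z" by (rule has_derivative_continuous[OF \<Gamma>_has_derivative])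
    then show ?thesis by (rule continuous_at_imp_continuous_at_within)
  next
    case False
    then have T: "fst z = T" using z by auto
    have bound: "norm (\<Gamma> x - c) \<le> 3 * (\<alpha> * B) * (T - fst x)" if x: "x \<in> {0..T} \<times> {0..}" for x
    proof (cases "fst x < T")
      case True
      then have d: "x \<in> dom" using x strip_subset_dom by (cases x) auto
      have "0 \<le> B * snd x" using x B_pos by auto
      then have f: "0 < f (snd x)" "f (snd x) \<le> \<alpha> * B"
        using f_pos[of "snd x"] divide_left_mono[of 1 "B * snd x + 1" "\<alpha> * B"] \<alpha>_pos B_pos
        by (simp_all add: f_def)
      have "\<bar>W (X x)\<bar> \<le> 3 * f (snd x) * (T - fst x)"
        using W_bound[of "fst (X x)" "snd (X x)"] X[OF d] by simp
      also have "\<dots> \<le> 3 * (\<alpha> * B) * (T - fst x)" using f True by (intro mult_right_mono) auto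
      finally show ?thesis using True by (simp add: \<Gamma>_def)
    qed (use x \<alpha>_pos B_pos in \<open>auto simp: \<Gamma>_def\<close>)
    have "((\<lambda>x. \<Gamma> x - c) \<longlongrightarrow> 0) (at z within {0..T} \<times> {0..})"
    proof (rule Lim_null_comparison)
      show "\<forall>\<^sub>F x in at z within {0..T} \<times> {0..}. norm (\<Gamma> x - c) \<le> 3 * (\<alpha> * B) * (T - fst x)"
        unfolding eventually_at_topological using bound by auto
      have "((\<lambda>x. 3 * (\<alpha> * B) * (T - fst x)) \<longlongrightarrow> 3 * (\<alpha> * B) * (T - fst z)) (at z within {0..T} \<times> {0..})"
        by (intro tendsto_intros)
      then show "((\<lambda>x. 3 * (\<alpha> * B) * (T - fst x)) \<longlongrightarrow> 0) (at z within {0..T} \<times> {0..})"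
        using T by simp
    qed
    moreover have "\<Gamma> z = c" using T by (simp add: \<Gamma>_def)
    ultimately show ?thesis unfolding continuous_within by (simp only: LIM_zero_iff)
  qed
qed

lemma \<Gamma>_terminal: "\<Gamma> (T, u) = c"
  by (simp add: \<Gamma>_def)

lemma D_t_\<Gamma>:
  assumes "t \<in> {0..<T}" "u \<in> {0..}"
  shows "D_t T \<Gamma> t u = - fst (X (t, u))"
proof -
  have "(t, u) \<in> dom" using assms strip_subset_dom by auto
  from has_real_derivative_partial_fst[OF \<Gamma>_has_derivative[OF this]]
  have "((\<lambda>s. \<Gamma> (s, u)) has_vector_derivative - fst (X (t, u))) (at t within {0..<T})"
    unfolding has_real_derivative_iff_has_vector_derivative
    by (rule has_vector_derivative_at_within)
  moreover have "t islimpt {0..<T}"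
    using assms by (intro islimpt_subset[OF islimpt_greaterThanLessThan1[of t T]]) auto
  then have "at t within {0..<T} \<noteq> bot" by (simp add: trivial_limit_within)
  ultimately show ?thesis unfolding D_t_def by (intro vector_derivative_within)
qed

lemma D_u_\<Gamma>:
  assumes "t \<in> {0..<T}" "u \<in> {0..}"
  shows "D_u \<Gamma> t u = - snd (X (t, u))"
proof -
  have "(t, u) \<in> dom" using assms strip_subset_dom by auto
  from has_real_derivative_partial_snd[OF \<Gamma>_has_derivative[OF this]]
  have "((\<lambda>w. \<Gamma> (t, w)) has_vector_derivative - snd (X (t, u))) (at u within {0..})"
    unfolding has_real_derivative_iff_has_vector_derivative
    by (rule has_vector_derivative_at_within)
  moreover have "u islimpt {0..}"
    using assms by (intro islimpt_subset[OF islimpt_greaterThanLessThan1[of u "u + 1"]]) auto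
  then have "at u within {0..} \<noteq> bot" by (simp add: trivial_limit_within)
  ultimately show ?thesis unfolding D_u_def by (intro vector_derivative_within)
qed

text \<open>This is the energy relation \<open>E + h y = f u\<close> for the coordinates of
  \<open>X\<close>, read with \<open>E\<close> and \<open>y\<close> as the negative partial
  derivatives of \<open>\<Gamma>\<close>.\<close>

lemma \<Gamma>_pde:
  assumes "t \<in> {0..<T}" "u \<in> {0..}"
  shows "D_t T \<Gamma> t u + f u - h (- D_u \<Gamma> t u) = 0" "D_u \<Gamma> t u \<le> 0"
proof -
  have "(t, u) \<in> dom" using assms strip_subset_dom by auto
  from X[OF this] show "D_t T \<Gamma> t u + f u - h (- D_u \<Gamma> t u) = 0" "D_u \<Gamma> t u \<le> 0"
    using assms by (simp_all add: D_t_\<Gamma> D_u_\<Gamma>)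
qed

end

section \<open>The conjugate\<close>

locale conjugate_pair =
  fixes k k' K K' :: "real \<Rightarrow> real"
  assumes k_nonneg: "\<And>x. 0 \<le> x \<Longrightarrow> 0 \<le> k x"
    and k_convex: "convex_on {0..} k"
    and k_deriv: "\<And>x. 0 < x \<Longrightarrow> (k has_real_derivative k' x) (at x)"
    and k_zero: "k 0 = 0"
    and k'_pos: "\<And>x. 0 < x \<Longrightarrow> 0 < k' x"
    and k'_top: "filterlim k' at_top at_top"
    and K_deriv: "\<And>y. (K has_real_derivative K' y) (at y)"
    and K_conj: "\<And>y. 0 \<le> y \<Longrightarrow> K y = conjugate k y"
begin

text \<open>Beyond \<open>x\<^sub>1\<close> the tangent of \<open>k\<close> at
  \<open>x\<^sub>1\<close> rises at least as fast as the line of slope \<open>y\<close>. This yields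
  both finiteness of the supremum and its smallness near 0.\<close>

lemma conjugate_bound:
  assumes "0 < x\<^sub>1" "0 \<le> y" "y \<le> k' x\<^sub>1" "0 \<le> x"
  shows "x * y - k x \<le> x\<^sub>1 * y"
proof (cases "x \<le> x\<^sub>1")
  case True
  then have "x * y \<le> x\<^sub>1 * y" using assms by (intro mult_right_mono) auto
  then show ?thesis using k_nonneg[of x] assms by simp
next
  case False
  have "k' x\<^sub>1 * (x - x\<^sub>1) \<le> k x - k x\<^sub>1"
    using assms by (intro convex_on_imp_above_tangent[OF k_convex] has_field_derivative_at_within[OF k_deriv]) auto
  moreover have "y * (x - x\<^sub>1) \<le> k' x\<^sub>1 * (x - x\<^sub>1)"
    using False assms by (intro mult_right_mono) auto
  ultimately show ?thesis using k_nonneg[of x\<^sub>1] assms by (simp add: algebra_simps)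
qed

lemma conjugate_bdd: "0 \<le> y \<Longrightarrow> bdd_above ((\<lambda>x. x * y - k x) ` {0..})"
proof -
  assume y: "0 \<le> y"
  have "\<forall>\<^sub>F x in at_top. y \<le> k' x \<and> 0 < x"
    using k'_top by (intro eventually_conj eventually_gt_at_top) (simp add: filterlim_at_top)
  then obtain x\<^sub>1 where "y \<le> k' x\<^sub>1" "0 < x\<^sub>1"
    using eventually_happens trivial_limit_at_top_linorder by blast
  then show ?thesis using conjugate_bound[of x\<^sub>1 y] y by (intro bdd_aboveI[of _ "x\<^sub>1 * y"]) auto
qed

lemma K_ge: "0 \<le> y \<Longrightarrow> 0 \<le> x \<Longrightarrow> x * y - k x \<le> K y"
  using conjugate_bdd[of y] by (auto simp: K_conj conjugate_def intro!: cSUP_upper)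

lemma K_le: "0 \<le> y \<Longrightarrow> (\<And>x. 0 \<le> x \<Longrightarrow> x * y - k x \<le> B) \<Longrightarrow> K y \<le> B"
  by (auto simp: K_conj conjugate_def intro!: cSUP_least)

lemma K_nonneg: "0 \<le> y \<Longrightarrow> 0 \<le> K y"
  using K_ge[of y 0] k_zero by simp

lemma K_zero: "K 0 = 0"
  using K_nonneg[of 0] K_le[of 0 0] k_nonneg by fastforce

text \<open>The right-hand difference quotients, where \<open>K\<close> is the conjugate, are
  nonnegative, and at most \<open>e\<close> for y < \<open>k' e\<close>.\<close>

lemma K'_zero: "K' 0 = 0"
proof -
  have lim: "((\<lambda>y. K y / y) \<longlongrightarrow> K' 0) (at_right 0)"
    using K_deriv[of 0] by (auto simp: has_field_derivative_iff K_zero intro: filterlim_mono[OF _ _ at_le])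
  have "0 \<le> K' 0"
    by (rule tendsto_lowerbound[OF lim]) (auto simp: eventually_at_right_field K_nonneg intro!: exI[of _ 1])
  moreover have "K' 0 \<le> 0"
  proof (rule field_le_epsilon)
    fix e :: real assume e: "0 < e"
    have "\<forall>\<^sub>F y in at_right 0. K y / y \<le> e"
      unfolding eventually_at_right_field
    proof (intro exI[of _ "k' e"] conjI allI impI)
      fix y assume "0 < y" "y < k' e"
      then have "K y \<le> e * y" using conjugate_bound[of e y] e by (intro K_le) auto
      then show "K y / y \<le> e" using \<open>0 < y\<close> by (simp add: field_simps)
    qed (use k'_pos e in auto)
    then have "K' 0 \<le> e" by (rule tendsto_upperbound[OF lim]) simp
    then show "K' 0 \<le> 0 + e" by simp
  qed
  ultimately show ?thesis by simp
qed

lemma K_mono: "0 \<le> y \<Longrightarrow> y \<le> z \<Longrightarrow> K y \<le> K z"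
proof (rule K_le)
  fix x :: real assume "0 \<le> x" and yz: "0 \<le> y" "y \<le> z"
  then have "x * y \<le> x * z" by (intro mult_left_mono) auto
  then show "x * y - k x \<le> K z" using K_ge[of z x] yz \<open>0 \<le> x\<close> by simp
qed

lemma K'_nonneg:
  assumes "0 \<le> y"
  shows "0 \<le> K' y"
proof (rule ccontr)
  assume "\<not> 0 \<le> K' y"
  then obtain d where "0 < d" "\<And>h. 0 < h \<Longrightarrow> h < d \<Longrightarrow> K (y + h) < K y"
    using DERIV_neg_dec_right[OF K_deriv[of y]] by auto
  then have "K (y + d / 2) < K y" by simp
  then show False using K_mono[of y "y + d / 2"] assms \<open>0 < d\<close> by simp
qed

text \<open>A supremum of affine functions is convex.\<close>

lemma K_convex: "convex_on {0..} K"
proof (rule convex_onI)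
  fix s y z :: real assume s: "0 < s" "s < 1" and yz: "y \<in> {0..}" "z \<in> {0..}"
  then have nn: "0 \<le> (1 - s) * y + s * z" by auto
  show "K ((1 - s) *\<^sub>R y + s *\<^sub>R z) \<le> (1 - s) * K y + s * K z"
    unfolding real_scaleR_def
  proof (rule K_le[OF nn])
    fix x :: real assume x: "0 \<le> x"
    have "x * ((1 - s) * y + s * z) - k x = (1 - s) * (x * y - k x) + s * (x * z - k x)"
      by (simp add: algebra_simps)
    also have "\<dots> \<le> (1 - s) * K y + s * K z"
      using s yz x by (intro add_mono mult_left_mono K_ge) auto
    finally show "x * ((1 - s) * y + s * z) - k x \<le> (1 - s) * K y + s * K z" .
  qed
qed simp

text \<open>The endpoint 0 is not interior to the half-line and is treated separately: the tangent
  there is the zero line.\<close>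

lemma K_above_tangent:
  assumes "0 \<le> y" "0 \<le> z"
  shows "K y + K' y * (z - y) \<le> K z"
proof (cases "y = 0")
  case True
  then show ?thesis using K_zero K'_zero K_nonneg assms by simp
next
  case False
  then have "K' y * (z - y) \<le> K z - K y"
    using assms by (intro convex_on_imp_above_tangent[OF K_convex] has_field_derivative_at_within[OF K_deriv]) auto
  then show ?thesis by simp
qed

lemma K_unbounded: "\<exists>y\<ge>0. x \<le> K y"
proof (intro exI conjI)
  \<comment> \<open>Testing the supremum at 1 gives \<open>K y \<ge> y - k 1\<close>.\<close>
  show "x \<le> K (\<bar>x\<bar> + k 1)" using K_ge[of "\<bar>x\<bar> + k 1" 1] k_nonneg[of 1] by simp
qed (use k_nonneg[of 1] in simp)

end

section \<open>Existence and uniqueness for the given data\<close>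

theorem theorem5p4:
  fixes T \<sigma> \<sigma>\<^sub>0 \<gamma> \<mu>\<^sub>0 :: real
    and k k' k'' K :: "real \<Rightarrow> real"
  assumes "0 < T" and "0 < \<sigma>" and "0 < \<sigma>\<^sub>0" and "0 < \<gamma>"
    and k_nonneg: "\<And>x. 0 \<le> x \<Longrightarrow> 0 \<le> k x"
    and k_mono: "mono_on {0..} k"
    and k_convex: "convex_on {0..} k"
    and k_deriv: "\<And>x. 0 \<le> x \<Longrightarrow> (k has_real_derivative k' x) (at x within {0..})"
    and k'_deriv: "\<And>x. 0 \<le> x \<Longrightarrow> (k' has_real_derivative k'' x) (at x within {0..})"
    and k''_cont: "continuous_on {0..} k''"
    and k_zero: "k 0 = 0"
    and k''_pos: "\<And>x. 0 < x \<Longrightarrow> 0 < k'' x"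
    and k'_zero: "(k' \<longlongrightarrow> 0) (at_right 0)"
    and k'_top: "filterlim k' at_top at_top"
    and k''_zero: "(k'' \<longlongrightarrow> k'' 0) (at_right 0)" "0 < k'' 0"
    and K_C2: "C2_on UNIV K"
    and K_ext: "\<And>y. 0 \<le> y \<Longrightarrow> K y = conjugate k y"
  shows "\<exists>\<Gamma>. classical_solution T \<sigma> \<sigma>\<^sub>0 \<mu>\<^sub>0 (tilde \<gamma> K) \<Gamma> \<and>
    (\<forall>\<Delta>. classical_solution T \<sigma> \<sigma>\<^sub>0 \<mu>\<^sub>0 (tilde \<gamma> K) \<Delta> \<longrightarrow>
      (\<forall>p \<in> {0..T} \<times> {0..}. \<Delta> p = \<Gamma> p)) \<and>
    (\<forall>t\<in>{0..<T}. \<forall>u\<in>{0..}. D_u \<Gamma> t u \<le> 0)"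
proof -
  obtain K' where K': "\<And>y. (K has_real_derivative K' y) (at y)" "continuous_on UNIV K'"
    using C2_on_real_UNIV_D[OF K_C2] by blast
  have at: "at x within {0..} = at x" if "0 < x" for x :: real
    using that by (intro at_within_interior) auto
  have k'_cont: "continuous_on {0..} k'"
    unfolding continuous_on_eq_continuous_within
    using DERIV_continuous[OF k'_deriv] by (simp add: Ball_def)
  have "k' 0 = 0"
  proof -
    have "(k' \<longlongrightarrow> k' 0) (at_right 0)"
      using k'_cont by (auto simp: continuous_on_def intro: tendsto_within_subset)
    with k'_zero show ?thesis using tendsto_unique trivial_limit_at_right_real by blast
  qed
  have k'_pos: "0 < k' x" if "0 < x" for x
  proof -
    have "k' 0 < k' x"
    proof (rule DERIV_pos_imp_increasing_open[OF that])
      fix w assume "0 < w" "w < x"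
      then show "\<exists>d. (k' has_real_derivative d) (at w) \<and> 0 < d"
        using k'_deriv[of w] k''_pos[of w] at[of w] by auto
    qed (auto intro: continuous_on_subset[OF k'_cont])
    then show ?thesis using \<open>k' 0 = 0\<close> by simp
  qed
  interpret conjugate_pair k k' K K'
  proof
    show "(k has_real_derivative k' x) (at x)" if "0 < x" for x
      using k_deriv[of x] at[OF that] that by simp
  qed (fact k_nonneg k_convex k_zero k'_pos k'_top K'(1) K_ext)+
  define c where "c = - (\<mu>\<^sub>0\<^sup>2 / (2 * \<sigma>\<^sub>0\<^sup>2))"
  define H where "H = tilde \<gamma> K"
  define H' where "H' = (\<lambda>p. K' (- p / \<gamma>))"
  have H_deriv: "(H has_real_derivative H' p) (at p)" for p
  proof -
    have "((\<lambda>p. - p / \<gamma>) has_real_derivative - 1 / \<gamma>) (at p)"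
      using \<open>0 < \<gamma>\<close> by (auto intro!: derivative_eq_intros)
    from DERIV_cmult[OF DERIV_chain2[OF K'(1) this], of "- \<gamma>"] show ?thesis
      using \<open>0 < \<gamma>\<close> by (simp add: H_def H'_def tilde_def[abs_def])
  qed
  \<comment> \<open>With these parameters \<open>con.f\<close> is the given running term, and
    \<open>H p\<close> is the negative of the rescaled conjugate at \<open>- p\<close>.\<close>
  interpret con: hj_construction "1 / (2 * \<sigma>\<^sup>2)" "\<lambda>y. \<gamma> * K (y / \<gamma>)" "\<lambda>y. K' (y / \<gamma>)" T "\<sigma>\<^sub>0\<^sup>2" c
  proof
    fix y :: real
    have "((\<lambda>y. y / \<gamma>) has_real_derivative 1 / \<gamma>) (at y)"
      using \<open>0 < \<gamma>\<close> by (auto intro!: derivative_eq_intros)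
    from DERIV_cmult[OF DERIV_chain2[OF K'(1) this], of \<gamma>]
    show "((\<lambda>y. \<gamma> * K (y / \<gamma>)) has_real_derivative K' (y / \<gamma>)) (at y)"
      using \<open>0 < \<gamma>\<close> by simp
    show "\<exists>w\<ge>0. y \<le> \<gamma> * K (w / \<gamma>)"
    proof -
      obtain w where "0 \<le> w" "y / \<gamma> \<le> K w" using K_unbounded by blast
      then show ?thesis using \<open>0 < \<gamma>\<close> by (intro exI[of _ "\<gamma> * w"]) (auto simp: field_simps)
    qed
    show "continuous_on UNIV (\<lambda>y. K' (y / \<gamma>))"
      using \<open>0 < \<gamma>\<close> by (intro continuous_on_compose2[OF K'(2)] continuous_intros) auto
    show "0 \<le> K' (y / \<gamma>)" if "0 \<le> y"
      using that \<open>0 < \<gamma>\<close> by (intro K'_nonneg) simp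
  qed (use \<open>0 < T\<close> \<open>0 < \<sigma>\<close> \<open>0 < \<sigma>\<^sub>0\<close> K_zero in simp_all)
  define f' where "f' = (\<lambda>u. - (con.f u)\<^sup>2 / (1 / (2 * \<sigma>\<^sup>2)))"
  have f_pos: "0 < \<sigma>\<^sub>0\<^sup>2 * u + 1" if "0 \<le> u" for u
    using that by (intro add_nonneg_pos) auto
  interpret hj_strip T c con.f f' H H'
  proof
    show "f' u < 0" if "0 < u" for u
      using con.f_pos[OF f_pos[of u]] that \<open>0 < \<sigma>\<close> by (simp add: f'_def)
    have "\<sigma>\<^sub>0\<^sup>2 * u + 1 \<noteq> 0" if "0 < u" for u using f_pos[of u] that by simp
    then show "continuous_on {0<..} f'"
      unfolding f'_def con.f_def using \<open>0 < \<sigma>\<close> by (intro continuous_intros) auto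
    show "continuous_on UNIV H'"
      unfolding H'_def using \<open>0 < \<gamma>\<close> by (intro continuous_on_compose2[OF K'(2)] continuous_intros) auto
    show "H q \<le> H p + H' p * (q - p)" if "p \<le> 0" "q \<le> 0" for p q
    proof -
      have "K (- p / \<gamma>) + K' (- p / \<gamma>) * (- q / \<gamma> - - p / \<gamma>) \<le> K (- q / \<gamma>)"
        using that \<open>0 < \<gamma>\<close> by (intro K_above_tangent) (auto simp: divide_nonpos_pos)
      then have "\<gamma> * (K (- p / \<gamma>) + K' (- p / \<gamma>) * (- q / \<gamma> - - p / \<gamma>)) \<le> \<gamma> * K (- q / \<gamma>)"
        using \<open>0 < \<gamma>\<close> by (intro mult_left_mono) auto
      then show ?thesis
        using \<open>0 < \<gamma>\<close> by (simp add: H_def H'_def tilde_def algebra_simps)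
    qed
    show "0 \<le> H' p" if "p \<le> 0" for p
      unfolding H'_def using that \<open>0 < \<gamma>\<close> by (intro K'_nonneg) (simp add: divide_nonpos_pos)
  qed (use \<open>0 < T\<close> K'_zero in \<open>simp_all add: H'_def\<close>)
  have f_eq: "\<sigma>\<^sub>0\<^sup>2 / (2 * \<sigma>\<^sup>2) * (1 / (\<sigma>\<^sub>0\<^sup>2 * u + 1)) = con.f u" for u
    by (simp add: con.f_def)
  have sol: "classical_solution T \<sigma> \<sigma>\<^sub>0 \<mu>\<^sub>0 H con.\<Gamma>"
    unfolding classical_solution_def f_eq
    using con.\<Gamma>_C2 con.\<Gamma>_continuous_on con.\<Gamma>_terminal con.\<Gamma>_pde(1)
    by (auto simp: H_def tilde_def c_def)
  \<comment> \<open>The constructed solution is itself covered, so the comparison can be applied to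
    it and any other classical solution.\<close>
  have int: "interior_solution \<Delta> (\<lambda>z. D_u \<Delta> (fst z) (snd z))"
    if "classical_solution T \<sigma> \<sigma>\<^sub>0 \<mu>\<^sub>0 H \<Delta>" for \<Delta>
  proof (rule interior_solutionI)
    show "(con.f has_real_derivative f' u) (at u)" if "0 < u" for u
      unfolding f'_def using that by (intro con.f_deriv f_pos) auto
  qed (use that[unfolded classical_solution_def f_eq] H_deriv in \<open>auto simp: c_def\<close>)
  show ?thesis
    unfolding H_def[symmetric]
    using sol interior_solution_unique[OF int int[OF sol]] con.\<Gamma>_pde(2) by blast
qed

end
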